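(* Let $\alpha>-1$, let $N\ge1$ and $0\le d_1\le d_2\le\dots\le d_N$ be integers, let $\lambda_1,\dots,\lambda_N>0$, and let $c_1,\dots,c_N$ be pairwise distinct negative real numbers. Suppose that the discrete Sobolev inner product $$\langle f,g\rangle_{\mathsf s}=\int_0^\infty f(x)g(x)\,x^{\alpha}e^{-x}\,dx+\sum_{j=1}^{N}\lambda_j\,f^{(d_j)}(c_j)\,g^{(d_j)}(c_j)$$ is sequentially ordered, and let $S_n$ ($n\ge0$) be the corresponding monic orthogonal polynomial of degree $n$. Then: 1. Every point $c_j$ attracts exactly one zero of $S_n$ for sufficiently large $n$, while the remaining $n-N$ zeros are contained in $(0,\infty)$. This means: for every $r>0$ there exists a natural number $\mathcal{N}$ such that, if $n\ge\mathcal{N}$, the $n$ zeros $\xi_1,\dots,\xi_n$ of $S_n$ (suitably labelled) satisfy $\xi_j\in B(c_j,r)$ for $j=1,\dots,N$ and $\xi_i\in(0,\infty)$ for $i=N+1,\dots,n$. 2. The zeros of $S_n$ are real and simple for all sufficiently large $n$. 3. The zeros of $\{S_n\}_{n=1}^{\infty}$ are at a finite distance from $(0,\infty)$: there exists a constant $M>0$ such that, if $\xi$ is a zero of $S_n$ for some $n\ge1$, then $\inf_{x>0}|x-\xi|<M$.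
   Context: $S_n$ is the unique monic polynomial of degree $n$ with $\langle x^k,S_n\rangle_{\mathsf s}=0$ for $k=0,\dots,n-1$. $B(c,r)=\{\zeta\in\mathbb{C}:|\zeta-c|<r\}$. Zeros are complex zeros, listed with multiplicity. Sequentially ordered: let $\mathbf{Co}(A)$ denote the convex hull of $A\subset\mathbb{R}$ and $A^{\mathrm o}$ its interior. Put $\Delta_0=\mathbf{Co}\big([0,\infty)\cup\{c_j:d_j=0\}\big)$ and $\Delta_k=\mathbf{Co}\big(\{c_j:d_j=k\}\big)$ for $1\le k\le d_N$ (the convex hull of the empty set is empty). The inner product is called sequentially ordered if $\Delta_k\cap\big(\mathbf{Co}(\bigcup_{i=0}^{k-1}\Delta_i)\big)^{\mathrm o}=\emptyset$ for $k=1,2,\dots,d_N$. *)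

theory Defs
  imports "HOL-Analysis.Analysis" "HOL-Computational_Algebra.Computational_Algebra"
begin

definition sobolev_inner ::
  "real \<Rightarrow> nat \<Rightarrow> (nat \<Rightarrow> real) \<Rightarrow> (nat \<Rightarrow> real) \<Rightarrow> (nat \<Rightarrow> nat) \<Rightarrow> real poly \<Rightarrow> real poly \<Rightarrow> real" where
  "sobolev_inner \<alpha> N w c d f g =
     (LINT x:{0<..}|lborel. poly f x * poly g x * x powr \<alpha> * exp (- x))
     + (\<Sum>j=1..N. w j * poly ((pderiv ^^ d j) f) (c j) * poly ((pderiv ^^ d j) g) (c j))"

(* For \<alpha> > -1 and nonnegative w the form is positive definite on polynomials, so the
   description below has exactly one solution. *)
definition sobolev_poly ::
  "real \<Rightarrow> nat \<Rightarrow> (nat \<Rightarrow> real) \<Rightarrow> (nat \<Rightarrow> real) \<Rightarrow> (nat \<Rightarrow> nat) \<Rightarrow> nat \<Rightarrow> real poly" where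
  "sobolev_poly \<alpha> N w c d n =
     (THE p. degree p = n \<and> lead_coeff p = 1 \<and>
             (\<forall>k<n. sobolev_inner \<alpha> N w c d (monom 1 k) p = 0))"

definition sobolev_hull :: "nat \<Rightarrow> (nat \<Rightarrow> real) \<Rightarrow> (nat \<Rightarrow> nat) \<Rightarrow> nat \<Rightarrow> real set" where
  "sobolev_hull N c d k =
     convex hull ((if k = 0 then {0..} else {}) \<union> {c j | j. j \<in> {1..N} \<and> d j = k})"

(* As d is nondecreasing on {1..N}, d N is the largest order of derivative. *)
definition sequentially_ordered :: "nat \<Rightarrow> (nat \<Rightarrow> real) \<Rightarrow> (nat \<Rightarrow> nat) \<Rightarrow> bool" where
  "sequentially_ordered N c d \<longleftrightarrow>
     (\<forall>k\<in>{1..d N}. sobolev_hull N c d k \<inter>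
        interior (convex hull (\<Union>i\<in>{0..k - 1}. sobolev_hull N c d i)) = {})"

end

theory Submission
  imports Defs
begin

text \<open>
  Write $S_n = P H$, where $P$ collects the positive zeros of $S_n$. Multiplying by
  $\rho = \prod_j (x - c_j)^{d_j+1}$ removes the discrete part of the inner product, so $S_n$ is
  quasi-orthogonal for the Laguerre weight and has at least $n - \deg\rho$ sign changes on the
  half-line. Sequential ordering makes a Rolle count with the $N$ conditions
  $f^{(d_j)}(c_j) = 0$ lossless, which improves this to $n - N$ and gives $\deg H \le N$.

  Gauss quadrature at the zeros of the Laguerre polynomial $L_n$ shows that the zeros of $P$ and of
  $L_n$ interlace up to a bounded number of them. Hence, for $b > 0$, $|P(-b)|$ and $|L_n(-b)|$ agree
  up to a power of $n$, and $\sum 1/(z+b)$ over the zeros $z$ of $P$ tends to infinity. Since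
  $L_n(-b)^2/\|L_n\|^2$ outgrows every power of $n$ while $\|S_n\|/\|L_n\|$ is at most a power of
  $n$, the quotient $S_n^{(d_j)}(c_j)/P^{(d_j)}(c_j)$ tends to $0$. In the Leibniz expansion of
  $(PH)^{(d_j)}(c_j)$ the term $P^{(d_j)}(c_j)H(c_j)$ dominates, so $H(c_j)\to 0$ for each of the
  $N$ points. Being monic of degree at most $N$, $H$ converges to $\prod_j (x - c_j)$, and the
  intermediate value theorem gives a real zero near every $c_j$.
\<close>

section \<open>Polynomials given by their roots, and Taylor coefficients\<close>

text \<open>The obstacle is that only the derivative of order exactly d_j is controlled at c_j: a
  small S_n^(d_j)(c_j) says nothing about S_n(c_j) itself or about derivatives of other orders.
  Dividing by the Taylor coefficient of P of the same order resolves this. All zeros of P lie to the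
  right of c_j and their reciprocal distances have an unbounded sum, so as n grows each Taylor
  coefficient of P at c_j dominates the preceding ones.

  No asymptotic formula for orthogonal polynomials is used. Fixed powers of n may be lost at every
  comparison, because at -b all terms of L_n have the same sign and a single one of them already
  beats any prescribed power of n. Hence crude estimates suffice: the sum of all zeros of L_n as a
  bound for the largest one, and for the norm of S_n the test polynomial \<open>\<rho>\<close>
  L_{n-D}, with D the degree of \<open>\<rho>\<close>, in the minimum property of S_n.\<close>

definition root_poly :: "real multiset \<Rightarrow> real poly" where
  "root_poly A = (\<Prod>a\<in>#A. [:- a, 1:])"

lemma root_poly_empty [simp]: "root_poly {#} = 1"
  and root_poly_add_mset [simp]: "root_poly (add_mset a A) = [:- a, 1:] * root_poly A"
  by (simp_all add: root_poly_def)

lemma root_poly_nonzero [simp]: "root_poly A \<noteq> 0"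
  by (auto simp: root_poly_def prod_mset_zero_iff)

lemma lead_coeff_root_poly [simp]: "lead_coeff (root_poly A) = 1"
  by (induction A) (simp_all add: lead_coeff_mult del: mult_pCons_left)

lemma degree_root_poly [simp]: "degree (root_poly A) = size A"
  by (induction A) (simp_all add: degree_mult_eq del: mult_pCons_left)

lemma proots_root_poly [simp]: "proots (root_poly A) = A"
  by (induction A) (simp_all add: proots_mult del: mult_pCons_left)

lemma order_root_poly [simp]: "order x (root_poly A) = count A x"
  by (metis count_proots proots_root_poly root_poly_nonzero)

lemma poly_root_poly: "poly (root_poly A) x = (\<Prod>a\<in>#A. x - a)"
  by (induction A) (simp_all add: algebra_simps)

lemma poly_root_poly_eq_0 [simp]: "poly (root_poly A) x = 0 \<longleftrightarrow> x \<in># A"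
  by (induction A) auto

lemma root_poly_dvd:
  assumes "p \<noteq> 0" "A \<subseteq># proots p"
  shows "root_poly A dvd p"
  using assms
proof (induction A arbitrary: p)
  case (add a A)
  then have "a \<in># proots p" by (simp add: insert_subset_eq_iff)
  then have "poly p a = 0" using add.prems(1) by auto
  then obtain q where q: "p = [:- a, 1:] * q" by (metis dvd_def poly_eq_0_iff_dvd)
  then have "q \<noteq> 0" using add.prems(1) by auto
  then have "proots p = add_mset a (proots q)"
    unfolding q by (subst proots_mult) (auto simp: proots_linear_factor)
  then have "A \<subseteq># proots q" using add.prems(2) by simp
  then have "root_poly A dvd q" using add.IH \<open>q \<noteq> 0\<close> by blast
  then show ?case unfolding q root_poly_add_mset by (rule mult_dvd_mono[OF dvd_refl])
qed simp

text \<open>This is p^(i)(c) / i!. Reading it off as a coefficient after the shift turns the Leibniz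
  rule into a plain convolution without binomial factors.\<close>

definition taylor_coeff :: "real \<Rightarrow> nat \<Rightarrow> real poly \<Rightarrow> real" where
  "taylor_coeff c i p = coeff (pcompose p [:c, 1:]) i"

lemma taylor_coeff_0 [simp]: "taylor_coeff c 0 p = poly p c"
  by (simp add: taylor_coeff_def)

lemma taylor_coeff_smult: "taylor_coeff c i (smult t p) = t * taylor_coeff c i p"
  and taylor_coeff_sum: "taylor_coeff c i (sum f K) = (\<Sum>k\<in>K. taylor_coeff c i (f k))"
  by (simp_all add: taylor_coeff_def pcompose_smult pcompose_sum coeff_sum)

lemma taylor_coeff_mult:
  "taylor_coeff c d (p * q) = (\<Sum>i\<le>d. taylor_coeff c (d - i) p * taylor_coeff c i q)"
  unfolding taylor_coeff_def pcompose_mult mult.commute[of "p \<circ>\<^sub>p _"] coeff_mult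
  by (simp add: mult.commute)

lemma higher_pderiv_eq_taylor_coeff:
  "poly ((pderiv ^^ d) p) c = fact d * taylor_coeff c d p"
proof -
  have "(pderiv ^^ d) p \<circ>\<^sub>p [:c, 1:] = (pderiv ^^ d) (p \<circ>\<^sub>p [:c, 1:])"
  proof (induction d)
    case (Suc d)
    have "pderiv (q \<circ>\<^sub>p [:c, 1:]) = pderiv q \<circ>\<^sub>p [:c, 1:]" for q :: "real poly"
      by (simp add: pderiv_pcompose pderiv_pCons)
    then show ?case by (simp add: Suc.IH[symmetric])
  qed simp
  then have "poly ((pderiv ^^ d) p) c = coeff ((pderiv ^^ d) (p \<circ>\<^sub>p [:c, 1:])) 0"
    by (simp flip: \<open>(pderiv ^^ d) p \<circ>\<^sub>p _ = _\<close>)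
  then show ?thesis
    by (simp add: coeff_higher_pderiv taylor_coeff_def pochhammer_fact)
qed

lemma taylor_coeff_eq_0_if_dvd:
  assumes "[:- c, 1:] ^ Suc d dvd p"
  shows "taylor_coeff c d p = 0"
proof -
  obtain q where q: "p = [:- c, 1:] ^ Suc d * q" using assms by (auto simp: dvd_def)
  have "([:- c, 1:] ^ Suc d) \<circ>\<^sub>p [:c, 1:] = monom 1 (Suc d)"
    by (induction d) (simp_all add: pcompose_mult pcompose_pCons monom_altdef del: mult_pCons_left)
  then show ?thesis
    by (simp add: q taylor_coeff_def pcompose_mult coeff_monom_mult del: power_Suc)
qed

text \<open>The point is uniformity: the constant depends only on \<open>c\<close>, \<open>i\<close>
  and \<open>N\<close>. The Taylor coefficients of H can then be estimated by the size of its
  coefficients before that size is known to be bounded.\<close>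

lemma taylor_coeff_bound:
  "\<exists>C\<ge>0. \<forall>p. degree p \<le> N \<longrightarrow> \<bar>taylor_coeff c i p\<bar> \<le> C * (\<Sum>j\<le>N. \<bar>coeff p j\<bar>)"
proof (intro exI conjI allI impI)
  let ?C = "\<Sum>j\<le>N. \<bar>taylor_coeff c i (monom 1 j)\<bar>"
  show "?C \<ge> 0" by (simp add: sum_nonneg)
  fix p :: "real poly" assume "degree p \<le> N"
  then have "p = (\<Sum>j\<le>N. smult (coeff p j) (monom 1 j))"
    by (metis (no_types, lifting) mult.right_neutral poly_as_sum_of_monoms' smult_monom sum.cong)
  then have "taylor_coeff c i p = (\<Sum>j\<le>N. coeff p j * taylor_coeff c i (monom 1 j))"
    by (metis (no_types, lifting) sum.cong taylor_coeff_smult taylor_coeff_sum)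
  also have "\<bar>\<dots>\<bar> \<le> (\<Sum>j\<le>N. \<bar>coeff p j\<bar> * \<bar>taylor_coeff c i (monom 1 j)\<bar>)"
    by (rule order_trans[OF sum_abs]) (simp add: abs_mult)
  also have "\<dots> \<le> (\<Sum>j\<le>N. \<bar>coeff p j\<bar> * ?C)"
    by (intro sum_mono mult_left_mono member_le_sum) auto
  finally show "\<bar>taylor_coeff c i p\<bar> \<le> ?C * (\<Sum>j\<le>N. \<bar>coeff p j\<bar>)"
    by (subst mult.commute) (simp only: sum_distrib_right)
qed

text \<open>Divided by the product of all elements of \<open>A\<close>, the coefficient of index d
  becomes the elementary symmetric sum e_d of the reciprocals. In e_1 e_d every term of e_(d+1)
  occurs d + 1 times, and the terms with a repeated factor amount to at most (d / b) e_d, since each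
  reciprocal is at most 1 / b.\<close>

lemma coeff_prod_linear_growth:
  fixes A :: "real multiset"
  assumes "\<forall>a\<in>#A. b \<le> a" "b > 0"
  shows "coeff (\<Prod>a\<in>#A. [:a, 1:]) d \<ge> 0"
    and "((\<Sum>a\<in>#A. 1 / a) - d / b) * coeff (\<Prod>a\<in>#A. [:a, 1:]) d
           \<le> real (Suc d) * coeff (\<Prod>a\<in>#A. [:a, 1:]) (Suc d)"
proof -
  have "\<forall>d. coeff (\<Prod>a\<in>#A. [:a, 1:]) d \<ge> 0 \<and> 
      ((\<Sum>a\<in>#A. 1 / a) - d / b) * coeff (\<Prod>a\<in>#A. [:a, 1:]) d
           \<le> real (Suc d) * coeff (\<Prod>a\<in>#A. [:a, 1:]) (Suc d)" 
    using assms(1)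
  proof (induction A)
    case empty
    then show ?case using assms(2) by (auto simp: coeff_1)
  next
    case (add a A)
    define q where "q = (\<Prod>a\<in>#A. [:a, 1:])"
    define s where "s = (\<Sum>a\<in>#A. 1 / a)"
    have a: "b \<le> a" "a > 0" using add.prems assms(2) by auto
    have nn: "coeff q d \<ge> 0" and gr: "(s - d / b) * coeff q d \<le> real (Suc d) * coeff q (Suc d)" for d
      using add unfolding q_def s_def by auto
    have c: "coeff (\<Prod>a\<in>#add_mset a A. [:a, 1:]) d = a * coeff q d + (if d = 0 then 0 else coeff q (d - 1))" for d
      by (cases d) (auto simp: q_def)
    have ab: "1 / a \<le> 1 / b" using a assms(2) by (simp add: frac_le)
    show ?case
    proof (intro allI conjI)
      fix d
      show "coeff (\<Prod>a\<in>#add_mset a A. [:a, 1:]) d \<ge> 0" unfolding c using nn a by auto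
      have "(s + 1 / a - d / b) * (a * coeff q d + (if d = 0 then 0 else coeff q (d - 1)))
         \<le> real (Suc d) * (a * coeff q (Suc d) + coeff q d)"
      proof (cases d)
        case 0
        then show ?thesis using mult_left_mono[OF gr[of 0], of a] a by (simp add: field_simps)
      next
        case (Suc e)
        \<comment> \<open>As d = e + 1 and 1 / a is at most 1 / b, the reciprocal of the new element
          is paid for by lowering the index by one.\<close>
        have "(s + 1 / a - d / b) * coeff q e \<le> (s - e / b) * coeff q e"
          using ab nn[of e] by (intro mult_right_mono) (simp_all add: Suc add_divide_distrib)
        also have "\<dots> \<le> d * coeff q d" using gr[of e] Suc by simp
        finally have 1: "(s + 1 / a - d / b) * coeff q e \<le> d * coeff q d" .
        have 2: "a * ((s - d / b) * coeff q d) \<le> a * (real (Suc d) * coeff q (Suc d))" 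
          using gr[of d] a by (intro mult_left_mono) auto
        have "(s + 1 / a - d / b) * (a * coeff q d) = a * ((s - d / b) * coeff q d) + coeff q d"
          using a by (simp add: field_simps)
        with 1 2 show ?thesis by (simp add: Suc algebra_simps)
      qed
      then show "((\<Sum>a\<in>#add_mset a A. 1 / a) - d / b) * coeff (\<Prod>a\<in>#add_mset a A. [:a, 1:]) d
           \<le> real (Suc d) * coeff (\<Prod>a\<in>#add_mset a A. [:a, 1:]) (Suc d)"
        unfolding c by (simp add: s_def add.commute)
    qed
  qed
  then show "coeff (\<Prod>a\<in>#A. [:a, 1:]) d \<ge> 0"
    and "((\<Sum>a\<in>#A. 1 / a) - d / b) * coeff (\<Prod>a\<in>#A. [:a, 1:]) d
           \<le> real (Suc d) * coeff (\<Prod>a\<in>#A. [:a, 1:]) (Suc d)" by auto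
qed

text \<open>To the left of all roots the Taylor coefficients alternate in sign, so taking absolute
  values just flips the sign of every shifted root.\<close>

lemma abs_taylor_coeff_root_poly:
  assumes "\<forall>z\<in>#A. z > c"
  shows "\<bar>taylor_coeff c d (root_poly A)\<bar> = coeff (\<Prod>a\<in>#image_mset (\<lambda>z. z - c) A. [:a, 1:]) d"
proof -
  have *: "root_poly A \<circ>\<^sub>p [:c, 1:] = (\<Prod>a\<in>#image_mset (\<lambda>z. z - c) A. [:- a, 1:])"
    by (induction A) (simp_all add: pcompose_1 pcompose_mult pcompose_pCons del: mult_pCons_left)
  have **: "coeff (\<Prod>a\<in>#B. [:- a, 1:]) d = (-1) ^ (size B + d) * coeff (\<Prod>a\<in>#B. [:a, 1:]) d"
    for B :: "real multiset"
    by (induction B arbitrary: d)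
       (auto simp: coeff_1 coeff_pCons algebra_simps intro!: gr0I split: nat.splits)
  define B where "B = image_mset (\<lambda>z. z - c) A"
  have "coeff (\<Prod>a\<in>#B. [:a, 1:]) d \<ge> 0"
  proof (cases "B = {#}")
    case False
    show ?thesis
    proof (rule coeff_prod_linear_growth(1)[of _ "Min (set_mset B)"])
      show "\<forall>a\<in>#B. Min (set_mset B) \<le> a" by simp
      show "Min (set_mset B) > 0" using False assms by (auto simp: B_def)
    qed
  qed (auto simp: coeff_1)
  then show ?thesis unfolding taylor_coeff_def * B_def[symmetric] **
    by (simp add: abs_mult)
qed

text \<open>Once the sum of 1 / (z + b) is large, each Taylor coefficient at -b is negligible
  against the next one.\<close>

lemma taylor_coeff_root_poly_growth:
  assumes "\<forall>z\<in>#A. z > 0" "b > 0"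
  shows "((\<Sum>z\<in>#A. 1 / (z + b)) - d / b) * \<bar>taylor_coeff (- b) d (root_poly A)\<bar>
           \<le> real (Suc d) * \<bar>taylor_coeff (- b) (Suc d) (root_poly A)\<bar>"
proof -
  have "((\<Sum>a\<in>#image_mset (\<lambda>z. z - - b) A. 1 / a) - d / b) * 
       coeff (\<Prod>a\<in>#image_mset (\<lambda>z. z - - b) A. [:a, 1:]) d
           \<le> real (Suc d) * coeff (\<Prod>a\<in>#image_mset (\<lambda>z. z - - b) A. [:a, 1:]) (Suc d)"
    by (rule coeff_prod_linear_growth(2)) (use assms in \<open>auto intro: less_imp_le\<close>)
  moreover have "\<forall>z\<in>#A. z > - b" using assms by (auto intro: less_trans[of _ 0])
  ultimately show ?thesis by (subst (1 2) abs_taylor_coeff_root_poly) (simp_all add: o_def image_mset.compositionality)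
qed

text \<open>Elimination of one unknown: an equation with a nonzero coefficient is solved for the
  unknown \<open>k\<close> and substituted into the others. The lemma serves both for the existence
  of orthogonal polynomials and for a cofactor that satisfies the conditions at the mass
  points.\<close>

lemma underdetermined_system_nontrivial:
  fixes a :: "'i \<Rightarrow> 'j \<Rightarrow> real"
  assumes "finite I" "finite J" "card I < card J"
  shows "\<exists>x. (\<exists>j\<in>J. x j \<noteq> 0) \<and> (\<forall>i\<in>I. (\<Sum>j\<in>J. a i j * x j) = 0)"
  using assms
proof (induction I arbitrary: J a rule: finite_induct)
  case empty
  then show ?case by (intro exI[of _ "\<lambda>_. 1"]) (auto simp: card_gt_0_iff)
next
  case (insert i I)
  show ?case
  proof (cases "\<forall>j\<in>J. a i j = 0")
    case True
    obtain x where "\<exists>j\<in>J. x j \<noteq> 0" "\<forall>i\<in>I. (\<Sum>j\<in>J. a i j * x j) = 0"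
      using insert.IH[of J a] insert.prems insert.hyps by auto
    then show ?thesis using True by (intro exI[of _ x]) auto
  next
    case False
    then obtain k where k: "k \<in> J" "a i k \<noteq> 0" by auto
    define b where "b l j = a l j - a l k * a i j / a i k" for l j
    have "card I < card (J - {k})" using insert.prems insert.hyps k by simp
    then obtain x where x: "\<exists>j\<in>J - {k}. x j \<noteq> 0" "\<forall>l\<in>I. (\<Sum>j\<in>J - {k}. b l j * x j) = 0"
      using insert.IH[of "J - {k}" b] insert.prems by auto
    define s where "s = (\<Sum>j\<in>J - {k}. a i j * x j)"
    define y where "y = x(k := - s / a i k)"
    have y: "(\<Sum>j\<in>J. a l j * y j) = (\<Sum>j\<in>J - {k}. a l j * x j) - a l k * s / a i k" for l
    proof -
      have "(\<Sum>j\<in>J. a l j * y j) = a l k * y k + (\<Sum>j\<in>J - {k}. a l j * y j)"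
        using insert.prems k by (subst sum.remove[of J k]) auto
      also have "(\<Sum>j\<in>J - {k}. a l j * y j) = (\<Sum>j\<in>J - {k}. a l j * x j)"
        by (intro sum.cong) (auto simp: y_def)
      finally show ?thesis by (simp add: y_def)
    qed
    have "(\<Sum>j\<in>J. a l j * y j) = 0" if "l \<in> I" for l
    proof -
      have "(\<Sum>j\<in>J - {k}. b l j * x j)
          = (\<Sum>j\<in>J - {k}. a l j * x j - (a l k / a i k) * (a i j * x j))"
        by (intro sum.cong) (auto simp: b_def algebra_simps)
      also have "\<dots> = (\<Sum>j\<in>J - {k}. a l j * x j) - (a l k / a i k) * s"
        by (simp add: sum_subtractf sum_distrib_left s_def)
      finally show ?thesis using y x(2) that by simp
    qed
    moreover have "(\<Sum>j\<in>J. a i j * y j) = 0" unfolding y using k by (simp add: s_def)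
    moreover have "\<exists>j\<in>J. y j \<noteq> 0" using x(1) by (auto simp: y_def)
    ultimately show ?thesis by (intro exI[of _ y]) auto
  qed
qed

section \<open>Counting real roots\<close>

text \<open>Rolle between neighbouring points. That \<open>Y\<close> avoids \<open>X\<close> is
  recorded so that these zeros can be added to those which multiple zeros in \<open>X\<close> leave
  to the derivative; the bounds keep \<open>Y\<close> inside every interval that contains
  \<open>X\<close>.\<close>

lemma Rolle_many_points:
  fixes p :: "real poly"
  assumes "finite X" "X \<noteq> {}" "\<forall>x\<in>X. poly p x = 0"
  shows "\<exists>Y. finite Y \<and> Suc (card Y) = card X \<and> Y \<inter> X = {} \<and> 
             Y \<subseteq> {Min X..Max X} \<and> (\<forall>y\<in>Y. poly (pderiv p) y = 0)"
  using assms
proof (induction X rule: finite_linorder_max_induct)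
  case (insert b X)
  show ?case
  proof (cases "X = {}")
    case True
    then show ?thesis by (intro exI[of _ "{}"]) auto
  next
    case False
    then obtain Y where Y: "finite Y" "Suc (card Y) = card X" "Y \<inter> X = {}" 
      "Y \<subseteq> {Min X..Max X}" "\<forall>y\<in>Y. poly (pderiv p) y = 0"
      using insert by auto
    let ?a = "Max X"
    have ab: "?a < b" using insert.hyps False by auto
    obtain z where z: "?a < z" "z < b" "poly p b - poly p ?a = (b - ?a) * poly (pderiv p) z"
      using poly_MVT[OF ab, of p] by auto
    moreover have "poly p ?a = 0" "poly p b = 0"
      using insert.prems insert.hyps False by auto
    ultimately have "poly (pderiv p) z = 0" using ab by auto
    moreover have "z \<notin> Y" using Y(4) z by auto
    moreover have "z \<notin> X" using z insert.hyps(1) False by (auto dest: Max_ge)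
    moreover have "b \<notin> Y" using Y(4) ab by auto
    moreover have "b \<notin> X" using insert.hyps by auto
    moreover have "Min (insert b X) = Min X" "Max (insert b X) = b"
    proof -
      have "Min X < b" using insert.hyps False by auto
      then show "Min (insert b X) = Min X"
        using insert.hyps False by (subst Min_insert) (auto intro: min.absorb2 less_imp_le simp del: Min_less_iff)
      show "Max (insert b X) = b"
        using insert.hyps False by (intro Max_eqI) (auto intro: less_imp_le)
    qed
    moreover have "Min X \<le> ?a" using insert.hyps False by (meson Max_ge Min_in)
    ultimately show ?thesis
      using Y z insert.hyps ab by (intro exI[of _ "insert z Y"]) (auto simp: less_imp_le)
  qed
qed simp

section \<open>Zeros counted with multiplicity, and Rolle's theorem for them\<close>

definition roots_in :: "real set \<Rightarrow> real poly \<Rightarrow> real multiset" where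
  "roots_in A p = filter_mset (\<lambda>x. x \<in> A) (proots p)"

lemma count_roots_in: "p \<noteq> 0 \<Longrightarrow> count (roots_in A p) x = (if x \<in> A then order x p else 0)"
  by (simp add: roots_in_def)

lemma set_roots_in: "p \<noteq> 0 \<Longrightarrow> set_mset (roots_in A p) = {x\<in>A. poly p x = 0}"
  by (auto simp: roots_in_def)

lemma size_roots_in_le_degree: "size (roots_in A p) \<le> degree p"
  unfolding roots_in_def by (meson order_trans size_filter_mset_lesseq size_proots_le)

lemma size_roots_in_Un:
  "A \<inter> B = {} \<Longrightarrow> size (roots_in (A \<union> B) p) = size (roots_in A p) + size (roots_in B p)"
  unfolding roots_in_def size_union[symmetric]
  by (rule arg_cong[of _ _ size], rule multiset_eqI) auto

lemma size_roots_in_mono: "A \<subseteq> B \<Longrightarrow> size (roots_in A p) \<le> size (roots_in B p)"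
  unfolding roots_in_def
  by (intro size_mset_mono mset_subset_eqI) auto

lemma size_roots_in_finite:
  assumes "finite A" "p \<noteq> 0"
  shows "size (roots_in A p) = (\<Sum>x\<in>A. order x p)"
proof -
  have "size (roots_in A p) = (\<Sum>x\<in>{x\<in>A. poly p x = 0}. order x p)"
    unfolding size_multiset_overloaded_eq set_roots_in[OF assms(2)]
    by (intro sum.cong) (auto simp: count_roots_in assms)
  also have "\<dots> = (\<Sum>x\<in>A. order x p)"
    using assms(1) by (intro sum.mono_neutral_left) (auto simp: order_0I)
  finally show ?thesis .
qed

lemma card_le_size_roots_in:
  assumes "p \<noteq> 0" "X \<subseteq> A" "\<forall>x\<in>X. poly p x = 0"
  shows "card X \<le> size (roots_in A p)"
proof -
  have "X \<subseteq> set_mset (roots_in A p)" using assms by (auto simp: set_roots_in)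
  then have "card X \<le> card (set_mset (roots_in A p))" by (intro card_mono) auto
  also have "\<dots> \<le> size (roots_in A p)" 
    unfolding size_multiset_overloaded_eq card_eq_sum
    by (intro sum_mono) simp
  finally show ?thesis .
qed

text \<open>A zero of order m stays a zero of order m - 1, which costs one per distinct zero; Rolle
  returns one new zero for each gap between distinct zeros, so the net loss is at most one.\<close>

lemma size_roots_in_pderiv:
  fixes p :: "real poly"
  assumes "is_interval A" "p \<noteq> 0" "pderiv p \<noteq> 0"
  shows "size (roots_in A p) \<le> Suc (size (roots_in A (pderiv p)))"
proof (cases "{x\<in>A. poly p x = 0} = {}")
  case True
  then have "set_mset (roots_in A p) = {}" by (subst set_roots_in[OF assms(2)])
  then show ?thesis by simp
next
  case False
  define X where "X = {x\<in>A. poly p x = 0}"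
  have X: "finite X" "X \<noteq> {}" "\<forall>x\<in>X. poly p x = 0"
    using False poly_roots_finite[OF assms(2)] by (auto simp: X_def)
  obtain Y where Y: "finite Y" "Suc (card Y) = card X" "Y \<inter> X = {}" "Y \<subseteq> {Min X..Max X}"
       "\<forall>y\<in>Y. poly (pderiv p) y = 0"
    using Rolle_many_points[OF X] by blast
  have "Min X \<in> A" "Max X \<in> A" using Min_in[OF X(1,2)] Max_in[OF X(1,2)] by (simp_all add: X_def)
  then have "{Min X..Max X} \<subseteq> A" using assms(1) unfolding is_interval_1 by (meson atLeastAtMost_iff subsetI)
  then have YA: "Y \<subseteq> A" using Y by auto
  have "size (roots_in A p) = (\<Sum>x\<in>X. order x p)"
    unfolding size_multiset_overloaded_eq set_roots_in[OF assms(2)] X_def[symmetric]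
    by (intro sum.cong) (auto simp: count_roots_in assms X_def)
  also have "\<dots> = (\<Sum>x\<in>X. Suc (order x (pderiv p)))"
  proof (rule sum.cong[OF refl])
    fix x assume "x \<in> X"
    then show "order x p = Suc (order x (pderiv p))" using X(3) by (intro order_pderiv assms(2)) auto
  qed
  also have "\<dots> = (\<Sum>x\<in>X. order x (pderiv p)) + Suc (card Y)"
    using Y by (simp add: sum.distrib sum_Suc)
  also have "(\<Sum>x\<in>X. order x (pderiv p)) \<le> size (roots_in X (pderiv p))"
    by (simp add: size_roots_in_finite assms X(1))
  also have "card Y \<le> size (roots_in Y (pderiv p))"
    using card_le_size_roots_in[OF assms(3) order.refl] Y by auto
  also have "size (roots_in X (pderiv p)) + Suc (size (roots_in Y (pderiv p)))
      = Suc (size (roots_in (X \<union> Y) (pderiv p)))"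
    using Y by (subst size_roots_in_Un) auto
  also have "\<dots> \<le> Suc (size (roots_in A (pderiv p)))"
    using YA by (auto intro!: size_roots_in_mono simp: X_def)
  finally show ?thesis by simp
qed

text \<open>Each differentiation loses at most one zero, while every condition of order k
  contributes a new zero of the k-th derivative. After \<open>K\<close> differentiations the degree
  has dropped by \<open>K\<close> too, so the losses cancel and all conditions are counted. The
  lower bound \<open>K\<close> on the number of positive zeros keeps the derivatives up to order
  \<open>K\<close> from vanishing identically.\<close>

lemma degree_ge_if_sequential_conditions:
  fixes c :: "'i \<Rightarrow> real" and d :: "'i \<Rightarrow> nat"
  assumes J: "finite J" "inj_on c J" "\<And>j. j \<in> J \<Longrightarrow> c j < 0" "\<And>j. j \<in> J \<Longrightarrow> d j \<le> K"
    and seq: "\<And>i j. i \<in> J \<Longrightarrow> j \<in> J \<Longrightarrow> d i < d j \<Longrightarrow> c j < c i"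
    and f: "f \<noteq> 0" "K \<le> size (roots_in {0<..} f)"
           "\<And>j. j \<in> J \<Longrightarrow> poly ((pderiv ^^ d j) f) (c j) = 0"
  shows "size (roots_in {0<..} f) + card J \<le> degree f"
proof -
  \<comment> \<open>A ray unbounded to the right, reaching down to the leftmost point whose order is
    at most k; being upward closed, it is an interval on which Rolle applies.\<close>
  define I where "I k = {x. \<exists>y\<in>{0<..} \<union> c ` {j\<in>J. d j \<le> k}. y \<le> x}" for k
  have int: "is_interval (I k)" for k
    unfolding is_interval_1 I_def using order_trans by blast
  have deg: "K \<le> degree f" using f(2) size_roots_in_le_degree order_trans by blast
  have nz: "(pderiv ^^ k) f \<noteq> 0" if "k \<le> K" for k
  proof (cases "k = 0")
    case True
    then show ?thesis using f by simp
  next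
    case False
    have "coeff ((pderiv ^^ k) f) (degree f - k) \<noteq> 0"
      using that deg f(1) by (simp add: coeff_higher_pderiv pochhammer_eq_0_iff add_eq_0_iff_both_eq_0)
    then show ?thesis by auto
  qed
  have new: "card {j\<in>J. d j = k} \<le> size (roots_in (c ` {j\<in>J. d j = k}) ((pderiv ^^ k) f))" if "k \<le> K" for k
  proof -
    have "card {j\<in>J. d j = k} = card (c ` {j\<in>J. d j = k})"
      using J(2) by (intro card_image[symmetric]) (auto intro: inj_on_subset)
    also have "\<dots> \<le> size (roots_in (c ` {j\<in>J. d j = k}) ((pderiv ^^ k) f))"
      using f(3) by (intro card_le_size_roots_in nz that) auto
    finally show ?thesis .
  qed
  have "k \<le> K \<Longrightarrow> size (roots_in {0<..} f) + card {j\<in>J. d j \<le> k} \<le> size (roots_in (I k) ((pderiv ^^ k) f)) + k" for k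
  proof (induction k)
    case 0
    have "size (roots_in {0<..} f) + size (roots_in (c ` {j\<in>J. d j = 0}) f)
        = size (roots_in ({0<..} \<union> c ` {j\<in>J. d j = 0}) f)"
      using J by (subst size_roots_in_Un) (auto dest: order.asym)
    also have "\<dots> \<le> size (roots_in (I 0) f)"
      by (intro size_roots_in_mono) (auto simp: I_def)
    finally show ?case using new[of 0] by simp
  next
    case (Suc k)
    let ?C = "c ` {j\<in>J. d j = Suc k}"
    \<comment> \<open>This is where the ordering enters: a point of order k + 1 lies to the left of
      all points of smaller order and of the half-line, so its zero has not been counted
      yet.\<close>
    have disj: "I k \<inter> ?C = {}"
    proof -
      have "c j \<notin> I k" if "j \<in> J" "d j = Suc k" for j
        using seq[of _ j] J(3)[of j] that unfolding I_def by fastforce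
      then show ?thesis by auto
    qed
    have "{j\<in>J. d j \<le> Suc k} = {j\<in>J. d j \<le> k} \<union> {j\<in>J. d j = Suc k}" by auto
    then have "card {j\<in>J. d j \<le> Suc k} = card {j\<in>J. d j \<le> k} + card {j\<in>J. d j = Suc k}"
      using J(1) by (simp only:) (subst card_Un_disjoint, auto)
    moreover have "size (roots_in (I k) ((pderiv ^^ k) f)) \<le> Suc (size (roots_in (I k) ((pderiv ^^ Suc k) f)))"
      using size_roots_in_pderiv[OF int nz, of k] nz[of "Suc k"] Suc.prems by simp
    moreover have "size (roots_in (I k) ((pderiv ^^ Suc k) f)) + size (roots_in ?C ((pderiv ^^ Suc k) f))
        = size (roots_in (I k \<union> ?C) ((pderiv ^^ Suc k) f))"
      using disj by (rule size_roots_in_Un[symmetric])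
    moreover have "size (roots_in (I k \<union> ?C) ((pderiv ^^ Suc k) f)) 
        \<le> size (roots_in (I (Suc k)) ((pderiv ^^ Suc k) f))"
      by (intro size_roots_in_mono) (auto simp: I_def intro: le_SucI)
    ultimately show ?case using Suc.IH Suc.prems new[of "Suc k"] by linarith
  qed
  from this[of K] have "size (roots_in {0<..} f) + card {j\<in>J. d j \<le> K} 
       \<le> size (roots_in (I K) ((pderiv ^^ K) f)) + K" by simp
  also have "size (roots_in (I K) ((pderiv ^^ K) f)) \<le> degree f - K"
    using size_roots_in_le_degree[of "I K" "(pderiv ^^ K) f"] by (simp add: degree_higher_pderiv)
  also have "{j\<in>J. d j \<le> K} = J" using J by auto
  finally show ?thesis using deg by simp
qed

text \<open>A zero in \<open>A\<close> has order at least two, so a square can be split off without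
  changing the parity of any order or the sign. When no zero in \<open>A\<close> is left, the
  intermediate value theorem decides.\<close>

lemma poly_constant_sign_if_even_orders:
  fixes p :: "real poly"
  assumes "is_interval A" "p \<noteq> 0" "\<forall>x\<in>A. even (order x p)"
  shows "(\<forall>x\<in>A. poly p x \<ge> 0) \<or> (\<forall>x\<in>A. poly p x \<le> 0)"
  using assms(2,3)
proof (induction "degree p" arbitrary: p rule: less_induct)
  case less
  show ?case
  proof (cases "\<exists>a\<in>A. poly p a = 0")
    case True
    then obtain a where a: "a \<in> A" "poly p a = 0" by auto
    then have "order a p \<ge> 2" using less.prems order_root[of p a] by fastforce
    then have "[:- a, 1:] ^ 2 dvd p" by (simp add: order_divides)
    then obtain q where q: "p = [:- a, 1:] ^ 2 * q" by (auto simp: dvd_def)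
    have q0: "q \<noteq> 0" using less.prems q by auto
    have "degree p = 2 + degree q"
      unfolding q using q0 by (subst degree_mult_eq) (auto simp: degree_linear_power simp del: mult_pCons_left)
    moreover have "even (order x q)" if "x \<in> A" for x
    proof -
      have "order x p = order x ([:- a, 1:] ^ 2) + order x q" 
        unfolding q by (rule order_mult) (use less.prems q in auto)
      moreover have "even (order x ([:- a, 1:] ^ 2))"
        by (cases "x = a") (simp_all add: order_power_n_n order_0I)
      ultimately show ?thesis using less.prems that by auto
    qed
    ultimately have "(\<forall>x\<in>A. poly q x \<ge> 0) \<or> (\<forall>x\<in>A. poly q x \<le> 0)"
      using less.hyps[of q] q0 by auto
    then show ?thesis unfolding q by (auto simp: mult_nonneg_nonpos)
  next
    case False
    show ?thesis
    proof (rule ccontr)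
      assume "\<not> ?thesis"
      then obtain x y where xy: "x \<in> A" "y \<in> A" "poly p x < 0" "poly p y > 0" by (auto simp: not_le)
      then have "x \<noteq> y" by auto
      then obtain z where "min x y < z" "z < max x y" "poly p z = 0"
        using poly_IVT_pos[of x y p] poly_IVT_neg[of y x p] xy by (cases "x < y") auto
      moreover have "z \<in> A"
        using assms(1) xy(1,2) calculation(1,2) unfolding is_interval_1 by (smt (verit) max_def min_def)
      ultimately show False using False by auto
    qed
  qed
qed

text \<open>At interior points of \<open>A\<close> these are the sign changes. Parity of the order
  is used as the criterion because orders add under multiplication.\<close>

definition odd_roots_in :: "real set \<Rightarrow> real poly \<Rightarrow> real set" where
  "odd_roots_in A p = {x\<in>A. odd (order x p)}"

lemma odd_roots_in_subset: "odd_roots_in A p \<subseteq> {x\<in>A. poly p x = 0}"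
  by (auto simp: odd_roots_in_def) (metis even_zero order_0I)

lemma finite_odd_roots_in: "p \<noteq> 0 \<Longrightarrow> finite (odd_roots_in A p)"
  by (rule finite_subset[OF odd_roots_in_subset]) (simp add: poly_roots_finite)

text \<open>One linear factor for each root of odd order makes all orders in \<open>A\<close> even.
  The additional factor \<open>r\<close> leaves room for \<open>\<rho>\<close>, for the cofactor in
  the Rolle count, or for nodes outside \<open>A\<close>.\<close>

lemma constant_sign_mult_odd_roots:
  assumes "is_interval A" "p \<noteq> 0" "r \<noteq> 0" "\<forall>x\<in>A. poly r x \<noteq> 0"
  shows "(\<forall>x\<in>A. poly (p * root_poly (mset_set (odd_roots_in A p)) * r) x \<ge> 0) \<or>
         (\<forall>x\<in>A. poly (p * root_poly (mset_set (odd_roots_in A p)) * r) x \<le> 0)"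
proof (rule poly_constant_sign_if_even_orders[OF assms(1)])
  let ?q = "p * root_poly (mset_set (odd_roots_in A p)) * r"
  show "?q \<noteq> 0" using assms by simp
  show "\<forall>x\<in>A. even (order x ?q)"
  proof
    fix x assume "x \<in> A"
    then have "order x ?q = order x p + count (mset_set (odd_roots_in A p)) x"
      using assms by (simp add: order_mult order_0I)
    then show "even (order x ?q)" using \<open>x \<in> A\<close> finite_odd_roots_in[OF assms(2)]
      by (auto simp: odd_roots_in_def count_mset_set')
  qed
qed

section \<open>Orthogonality and Gauss quadrature\<close>

text \<open>The alternative \<open>p = q\<close> covers n = 0, where no degree lies below n.\<close>

lemma monic_diff_cases:
  fixes p q :: "real poly"
  assumes "degree p = n" "degree q = n" "lead_coeff p = 1" "lead_coeff q = 1"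
  shows "p = q \<or> degree (p - q) < n"
proof (cases "n = 0")
  case True
  then show ?thesis using assms by (auto elim!: degree_eq_zeroE)
next
  case False
  have "degree (p - q) \<le> n" using assms by (intro degree_diff_le) auto
  moreover have "coeff (p - q) n = 0" using assms by auto
  ultimately show ?thesis using False by (metis leading_coeff_0_iff degree_0 le_neq_implies_less neq0_conv)
qed

lemma poly_eq_sum_monom_less:
  fixes p :: "real poly"
  assumes "degree p < n"
  shows "p = (\<Sum>i<n. smult (coeff p i) (monom 1 i))"
  using assms
  by (intro poly_eqI) (auto simp: coeff_sum coeff_monom if_distrib sum.delta coeff_eq_0 cong: if_cong)

section \<open>Monic orthogonal polynomials of an abstract inner product\<close>

locale poly_inner =
  fixes B :: "real poly \<Rightarrow> real poly \<Rightarrow> real"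
  assumes sym: "B p q = B q p"
    and add_left: "B (p + p') q = B p q + B p' q"
    and smult_left: "B (smult t p) q = t * B p q"
    and pos: "p \<noteq> 0 \<Longrightarrow> B p p > 0"
begin

lemma zero_left [simp]: "B 0 q = 0"
  using smult_left[of 0 0 q] by simp

lemma diff_left: "B (p - p') q = B p q - B p' q"
  using add_left[of "p - p'" p' q] by simp

lemma add_right: "B q (p + p') = B q p + B q p'"
  and smult_right: "B q (smult t p) = t * B q p"
  and diff_right: "B q (p - p') = B q p - B q p'"
  using add_left smult_left diff_left by (simp_all add: sym[of q])

lemma sum_left: "B (sum f K) q = (\<Sum>k\<in>K. B (f k) q)"
  by (induction K rule: infinite_finite_induct) (simp_all add: add_left)

lemma sum_right: "B q (sum f K) = (\<Sum>k\<in>K. B q (f k))"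
  using sum_left sym by simp

definition is_orth :: "nat \<Rightarrow> real poly \<Rightarrow> bool" where
  "is_orth n p \<longleftrightarrow> degree p = n \<and> lead_coeff p = 1 \<and> (\<forall>k<n. B (monom 1 k) p = 0)"

lemma is_orth_low_degree:
  assumes "is_orth n p" "degree q < n"
  shows "B q p = 0"
proof -
  have "B q p = (\<Sum>i<n. coeff q i * B (monom 1 i) p)"
    using assms(2) by (subst poly_eq_sum_monom_less[of q n]) (simp_all add: sum_left smult_left)
  then show ?thesis using assms(1) by (simp add: is_orth_def)
qed

lemma is_orth_unique:
  assumes "is_orth n p" "is_orth n q"
  shows "p = q"
proof (rule ccontr)
  assume "p \<noteq> q"
  then have "degree (p - q) < n" using monic_diff_cases[of p n q] assms by (auto simp: is_orth_def)
  then have "B (p - q) (p - q) = 0"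
    using is_orth_low_degree[OF assms(1)] is_orth_low_degree[OF assms(2)] by (simp add: diff_right)
  then show False using pos[of "p - q"] \<open>p \<noteq> q\<close> by simp
qed

lemma is_orth_exists: "\<exists>p. is_orth n p"
proof -
  obtain x where x: "\<exists>j\<in>{..n}. x j \<noteq> 0"
      "\<forall>i\<in>{..<n}. (\<Sum>j\<in>{..n}. B (monom 1 i) (monom 1 j) * x j) = 0"
    using underdetermined_system_nontrivial[of "{..<n}" "{..n}" "\<lambda>i j. B (monom 1 i) (monom 1 j)"] by auto
  define p where "p = (\<Sum>j\<le>n. smult (x j) (monom 1 j))"
  have c: "coeff p j = (if j \<le> n then x j else 0)" for j
    by (simp add: p_def coeff_sum coeff_monom if_distrib sum.delta cong: if_cong)
  have p0: "p \<noteq> 0" using x(1) c by (metis atMost_iff coeff_0)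
  have orth: "B (monom 1 i) p = 0" if "i < n" for i
    using x(2) that by (simp add: p_def sum_right smult_right mult.commute)
  have deg: "degree p \<le> n" by (rule degree_le) (simp add: c)
  \<comment> \<open>Without its top coefficient \<open>p\<close> would have degree below n and thus
    be orthogonal to itself.\<close>
  have "x n \<noteq> 0"
  proof
    assume "x n = 0"
    then have "n \<noteq> 0" using x(1) by (metis atMost_0 atMost_iff le_zero_eq)
    then have "degree p < n" using deg p0 \<open>x n = 0\<close> c[of n] by (metis le_neq_implies_less leading_coeff_0_iff order_refl)
    have "B p p = (\<Sum>i<n. coeff p i * B (monom 1 i) p)"
      by (subst poly_eq_sum_monom_less[OF \<open>degree p < n\<close>]) (simp add: sum_left smult_left)
    then show False using orth pos[OF p0] by simp
  qed
  then have "degree p = n" using deg c[of n] by (metis le_antisym le_degree order_refl)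
  then have "is_orth n (smult (1 / x n) p)"
    using \<open>x n \<noteq> 0\<close> c[of n] orth by (simp add: is_orth_def smult_right)
  then show ?thesis by blast
qed

text \<open>Pythagoras, as f - p has lower degree than p. Any monic test polynomial of degree n
  therefore bounds the norm of the orthogonal polynomial.\<close>

lemma is_orth_minimal:
  assumes "is_orth n p" "degree f = n" "lead_coeff f = 1"
  shows "B p p \<le> B f f"
proof (cases "f = p")
  case False
  then have "degree (f - p) < n" using monic_diff_cases[of f n p] assms by (auto simp: is_orth_def)
  then have 0: "B (f - p) p = 0" by (rule is_orth_low_degree[OF assms(1)])
  have "B f f = B (p + (f - p)) (p + (f - p))" by simp
  also have "\<dots> = B p p + B (f - p) (f - p)"
    using 0 sym[of p "f - p"] by (simp only: add_left add_right)
  finally show ?thesis using pos[of "f - p"] False by simp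
qed simp

end

text \<open>Distinct roots already exhaust the degree. Simplicity of zeros is always obtained in
  this way, for the Laguerre polynomials as well as for S_n.\<close>

lemma monic_eq_root_poly:
  assumes "degree p = n" "lead_coeff p = 1" "finite R" "\<forall>x\<in>R. poly p x = 0" "n \<le> card R"
  shows "p = root_poly (mset_set R)" "card R = n"
proof -
  have p0: "p \<noteq> 0" using assms by auto
  have "mset_set R \<subseteq># proots p"
    using assms p0 by (intro mset_subset_eqI) (auto simp: count_mset_set' Suc_le_eq order_gt_0_iff)
  then have "root_poly (mset_set R) dvd p" using p0 by (rule root_poly_dvd[rotated])
  then obtain q where q: "p = root_poly (mset_set R) * q" by (auto simp: dvd_def)
  then have "q \<noteq> 0" using p0 by auto
  then have "n = card R + degree q" using q assms(1) by (simp add: degree_mult_eq)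
  with assms(5) have "degree q = 0" "card R = n" by auto
  moreover have "lead_coeff q = 1"
    using assms(2) unfolding q by (simp only: lead_coeff_mult lead_coeff_root_poly mult_1_left)
  ultimately have "q = 1" by (metis degree_eq_zeroE lead_coeff_pCons(2) pCons_one)
  then show "p = root_poly (mset_set R)" using q by simp
  show "card R = n" by fact
qed

section \<open>Comparing sums by comparing counts above every threshold\<close>

lemma sum_mset_nonneg: "\<forall>a\<in>#A. a \<ge> 0 \<Longrightarrow> sum_mset A \<ge> (0::real)"
  by (induction A) auto

text \<open>The largest element \<open>b\<close> of \<open>B\<close> is matched with some element of
  \<open>A\<close> that is at least \<open>b\<close>. Removing the pair preserves the counts for
  thresholds up to \<open>b\<close>, and above \<open>b\<close> nothing of \<open>B\<close> is left.
  The lemma turns counts of zeros in intervals into inequalities between sums over zeros.\<close>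

lemma sum_mset_le_if_counts_le:
  fixes A B :: "real multiset"
  assumes "\<And>s. size (filter_mset (\<lambda>x. s \<le> x) B) \<le> size (filter_mset (\<lambda>x. s \<le> x) A)"
    and "\<forall>a\<in>#A. a \<ge> 0"
  shows "sum_mset B \<le> sum_mset A"
  using assms
proof (induction "size B" arbitrary: A B)
  case 0
  then show ?case by (auto intro: sum_mset_nonneg)
next
  case (Suc n)
  then have "B \<noteq> {#}" by auto
  define b where "b = Max (set_mset B)"
  have b: "b \<in># B" "\<And>x. x \<in># B \<Longrightarrow> x \<le> b" using \<open>B \<noteq> {#}\<close> by (auto simp: b_def)
  have "filter_mset (\<lambda>x. b \<le> x) B \<noteq> {#}" using b(1) by (auto simp: filter_mset_eq_mempty_iff)
  then have "filter_mset (\<lambda>x. b \<le> x) A \<noteq> {#}" using Suc.prems(1)[of b] by (metis le_zero_eq size_eq_0_iff_empty)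
  then obtain a where a: "a \<in># A" "b \<le> a" by (auto simp: filter_mset_eq_mempty_iff)
  obtain A' B' where A': "A = add_mset a A'" and B': "B = add_mset b B'"
    using a(1) b(1) by (metis insert_DiffM)
  have "sum_mset B' \<le> sum_mset A'"
  proof (rule Suc.hyps(1))
    show "n = size B'" using Suc.hyps(2) B' by simp
    show "\<forall>a\<in>#A'. a \<ge> 0" using Suc.prems(2) A' by simp
    fix s
    show "size (filter_mset (\<lambda>x. s \<le> x) B') \<le> size (filter_mset (\<lambda>x. s \<le> x) A')"
    proof (cases "s \<le> b")
      case True
      then show ?thesis using Suc.prems(1)[of s] a by (simp add: A' B')
    next
      case False
      then have "filter_mset (\<lambda>x. s \<le> x) B' = {#}" using b(2) B' by (fastforce simp: filter_mset_eq_mempty_iff)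
      then show ?thesis by (simp only: size_empty le0)
    qed
  qed
  then show ?case using a by (simp add: A' B')
qed

lemma is_interval_pos: "is_interval {0::real<..}"
  by (auto simp: is_interval_1)

text \<open>Counting zeros on the half-line rests on linearity and positivity alone; the Laguerre
  weight enters later through its moments.\<close>

locale positive_functional =
  fixes I :: "real poly \<Rightarrow> real"
  assumes I_add: "I (p + q) = I p + I q"
    and I_smult: "I (smult t p) = t * I p"
    and I_pos: "p \<noteq> 0 \<Longrightarrow> \<forall>x>0. poly p x \<ge> 0 \<Longrightarrow> I p > 0"
begin

lemma I_0 [simp]: "I 0 = 0"
  using I_smult[of 0 0] by simp

lemma I_sum: "I (sum f K) = (\<Sum>k\<in>K. I (f k))"
  by (induction K rule: infinite_finite_induct) (simp_all add: I_add)

lemma I_nonneg: "\<forall>x>0. poly p x \<ge> 0 \<Longrightarrow> I p \<ge> 0"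
  using I_pos[of p] by (cases "p = 0") auto

lemma I_nonzero_if_constant_sign:
  assumes "p \<noteq> 0" "(\<forall>x\<in>{0<..}. poly p x \<ge> 0) \<or> (\<forall>x\<in>{0<..}. poly p x \<le> 0)"
  shows "I p \<noteq> 0"
  using assms(2)
proof
  assume "\<forall>x\<in>{0<..}. poly p x \<ge> 0"
  then show ?thesis using I_pos[of p] assms(1) by auto
next
  assume "\<forall>x\<in>{0<..}. poly p x \<le> 0"
  then have "I (smult (-1) p) > 0" using assms(1) by (intro I_pos) auto
  then show ?thesis unfolding I_smult by simp
qed

text \<open>With fewer than n sign changes, the polynomial vanishing at exactly these would have
  degree below n and give a product with \<open>L\<close> of constant sign.\<close>

lemma orthogonal_roots:
  assumes L: "degree L = n" "lead_coeff L = 1" "\<And>q. degree q < n \<Longrightarrow> I (L * q) = 0"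
  obtains Y where "finite Y" "Y \<subseteq> {0<..}" "card Y = n" "L = root_poly (mset_set Y)"
proof -
  define Y where "Y = odd_roots_in {0<..} L"
  have L0: "L \<noteq> 0" using L by auto
  have fin: "finite Y" using finite_odd_roots_in[OF L0] by (simp add: Y_def)
  have "card Y \<ge> n"
  proof (rule ccontr)
    assume "\<not> card Y \<ge> n"
    then have "I (L * root_poly (mset_set Y)) = 0" using L by simp
    moreover have "I (L * root_poly (mset_set Y) * 1) \<noteq> 0" unfolding Y_def
      by (intro I_nonzero_if_constant_sign constant_sign_mult_odd_roots is_interval_pos) (use L0 in auto)
    ultimately show False by simp
  qed
  moreover have "\<forall>y\<in>Y. poly L y = 0" using odd_roots_in_subset[of "{0<..}" L] unfolding Y_def by blast
  ultimately have "L = root_poly (mset_set Y)" "card Y = n"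
    using monic_eq_root_poly[OF L(1,2) fin] by blast+
  moreover have "Y \<subseteq> {0<..}" using odd_roots_in_subset[of "{0<..}" L] unfolding Y_def by blast
  ultimately show ?thesis using that fin by blast
qed

text \<open>Division by \<open>L\<close> leaves a remainder that Lagrange interpolation at
  \<open>Y\<close> reproduces, and the quotient part integrates to zero. The weights are positive
  because they are the integrals of the squares of the Lagrange basis polynomials, whose degree
  still lies below 2n.\<close>

lemma Gauss_quadrature:
  assumes Y: "finite Y" "card Y = n" and L: "L = root_poly (mset_set Y)"
    and orth: "\<And>q. degree q < n \<Longrightarrow> I (L * q) = 0"
  obtains v where "\<And>y. y \<in> Y \<Longrightarrow> v y > 0"
    "\<And>g. degree g < 2 * n \<Longrightarrow> I g = (\<Sum>y\<in>Y. v y * poly g y)"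
proof -
  define Q where "Q y = root_poly (mset_set (Y - {y}))" for y
  define l where "l y = smult (1 / poly (Q y) y) (Q y)" for y
  define v where "v y = I (l y)" for y
  have Q: "poly (Q y) y \<noteq> 0" for y using Y by (simp add: Q_def)
  have l: "poly (l y) x = (if x = y then 1 else 0)" if "x \<in> Y" "y \<in> Y" for x y
    using that Y Q[of y] by (auto simp: l_def Q_def)
  have degl: "degree (l y) < n" if "y \<in> Y" for y
    using that Y Q[of y] card_gt_0_iff[of Y] by (auto simp: l_def Q_def)
  have degL: "degree L = n" "L \<noteq> 0" using Y by (simp_all add: L)
  have quad: "I g = (\<Sum>y\<in>Y. v y * poly g y)" if g: "degree g < 2 * n" for g
  proof -
    define q r where "q = g div L" and "r = g mod L"
    have gqr: "g = L * q + r" by (simp add: q_def r_def)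
    have degr: "degree r < n"
      using degree_mod_less[of L g] degL g by (auto simp: r_def)
    have "degree q < n"
    proof (cases "q = 0")
      case False
      have "n + degree q = degree (L * q)" using degL False by (simp add: degree_mult_eq)
      also have "L * q = g - r" using gqr by simp
      also have "degree \<dots> < 2 * n" using degr g by (intro degree_diff_less) auto
      finally show ?thesis by simp
    qed (use degr in simp)
    then have "I g = I r" using orth by (simp add: gqr I_add)
    moreover have rg: "poly r y = poly g y" if "y \<in> Y" for y using that Y by (simp add: gqr L)
    moreover have "r = (\<Sum>y\<in>Y. smult (poly r y) (l y))"
    proof (rule poly_eqI_degree[of Y])
      show "poly r x = poly (\<Sum>y\<in>Y. smult (poly r y) (l y)) x" if "x \<in> Y" for x
        using that Y by (simp add: poly_sum l if_distrib sum.delta' cong: if_cong)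
      have "degree (\<Sum>y\<in>Y. smult (poly r y) (l y)) \<le> n - 1"
        using degl by (intro degree_sum_le Y) (fastforce intro: order_trans[OF degree_smult_le])
      then show "degree (\<Sum>y\<in>Y. smult (poly r y) (l y)) < card Y" "degree r < card Y" using degr Y by auto
    qed
    then have "I r = (\<Sum>y\<in>Y. poly r y * v y)" 
      by (metis (no_types, lifting) I_smult I_sum sum.cong v_def)
    ultimately show ?thesis by (simp add: mult.commute cong: sum.cong)
  qed
  moreover have "v y > 0" if "y \<in> Y" for y
  proof -
    have "l y \<noteq> 0" using l[OF that that] by auto
    have "degree (l y * l y) < 2 * n" using degl[OF that] degree_mult_le[of "l y" "l y"] by simp
    then have "I (l y * l y) = (\<Sum>x\<in>Y. v x * poly (l y * l y) x)" by (rule quad)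
    also have "\<dots> = v y" using that Y by (simp add: l if_distrib sum.delta cong: if_cong)
    finally show ?thesis using I_pos[of "l y * l y"] \<open>l y \<noteq> 0\<close> by simp
  qed
  ultimately show ?thesis using that by blast
qed

text \<open>If the bound failed, \<open>q\<close> would have small enough degree for
  quasi-orthogonality. Quadrature at \<open>Y\<close> then writes 0 as a sum over the nodes in
  \<open>A\<close> whose terms all have the same sign, so \<open>S\<close> vanishes at every node in
  \<open>A\<close>, and the bound holds after all. Allowing every interval \<open>A\<close> makes
  this a statement about interlacing.\<close>

lemma orthogonal_root_count:
  assumes Y: "finite Y" "card Y = n" and L: "L = root_poly (mset_set Y)"
    and orth: "\<And>q. degree q < n \<Longrightarrow> I (L * q) = 0"
    and S: "S \<noteq> 0" "degree S \<le> n"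
    and \<rho>: "\<And>x. x > 0 \<Longrightarrow> poly \<rho> x > 0"
    and qorth: "\<And>q. degree q + degree \<rho> < n \<Longrightarrow> I (S * (\<rho> * q)) = 0"
    and A: "is_interval A" "A \<subseteq> {0<..}"
  shows "card (Y \<inter> A) \<le> size (roots_in A S) + degree \<rho>"
proof -
  define X where "X = odd_roots_in A S"
  \<comment> \<open>The first factor cancels the sign changes of \<open>S\<close> inside
    \<open>A\<close>, the second removes the nodes outside \<open>A\<close> from the quadrature
    sum.\<close>
  define q where "q = root_poly (mset_set X) * root_poly (mset_set (Y - A))"
  have finX: "finite X" unfolding X_def by (rule finite_odd_roots_in[OF S(1)])
  have X: "X \<subseteq> {x\<in>A. poly S x = 0}" unfolding X_def by (rule odd_roots_in_subset)
  have sizeX: "card X \<le> size (roots_in A S)" using X S by (intro card_le_size_roots_in) auto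
  have degq: "degree q = card X + card (Y - A)" by (simp add: q_def degree_mult_eq)
  have cardY: "card (Y \<inter> A) + card (Y - A) = n" using Y by (metis card_Int_Diff)
  show ?thesis
  proof (cases "degree q + degree \<rho> < n")
    case False
    then show ?thesis using sizeX degq cardY by simp
  next
    case True
    obtain v where v: "\<And>y. y \<in> Y \<Longrightarrow> v y > 0" 
      "\<And>g. degree g < 2 * n \<Longrightarrow> I g = (\<Sum>y\<in>Y. v y * poly g y)"
      using Gauss_quadrature[OF Y L orth] by blast
    have sgn: "(\<forall>x\<in>A. poly (S * q) x \<ge> 0) \<or> (\<forall>x\<in>A. poly (S * q) x \<le> 0)"
      unfolding q_def mult.assoc[symmetric] X_def
      by (intro constant_sign_mult_odd_roots A S) (use Y in auto)
    have "degree (S * (\<rho> * q)) < 2 * n"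
      using degree_mult_le[of S "\<rho> * q"] degree_mult_le[of \<rho> q] True S(2) by linarith
    then have "0 = (\<Sum>y\<in>Y. v y * poly (S * (\<rho> * q)) y)" using v(2) qorth[OF True] by simp
    also have "\<dots> = (\<Sum>y\<in>Y \<inter> A. v y * poly (S * (\<rho> * q)) y)"
      using Y by (intro sum.mono_neutral_right) (auto simp: q_def)
    also have "\<dots> = (\<Sum>y\<in>Y \<inter> A. v y * poly \<rho> y * poly (S * q) y)"
      by (intro sum.cong) (auto simp: algebra_simps)
    finally have sum0: "(\<Sum>y\<in>Y \<inter> A. v y * poly \<rho> y * poly (S * q) y) = 0" by simp
    have pos: "v y * poly \<rho> y > 0" if "y \<in> Y \<inter> A" for y using that A v(1) \<rho> by auto
    have "\<forall>y\<in>Y \<inter> A. v y * poly \<rho> y * poly (S * q) y = 0"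
      using sgn
    proof
      assume "\<forall>x\<in>A. poly (S * q) x \<ge> 0"
      then have "\<forall>y\<in>Y \<inter> A. v y * poly \<rho> y * poly (S * q) y \<ge> 0"
        using pos by (intro ballI mult_nonneg_nonneg[OF less_imp_le[OF pos]]) auto
      then show ?thesis using sum_nonneg_eq_0_iff[THEN iffD1, OF _ _ sum0] Y by blast
    next
      assume "\<forall>x\<in>A. poly (S * q) x \<le> 0"
      then have "\<forall>y\<in>Y \<inter> A. v y * poly \<rho> y * poly (S * q) y \<le> 0"
        using pos by (intro ballI mult_nonneg_nonpos[OF less_imp_le[OF pos]]) auto
      then have "\<forall>y\<in>Y \<inter> A. 0 \<le> - (v y * poly \<rho> y * poly (S * q) y)" by simp
      moreover have "(\<Sum>y\<in>Y \<inter> A. - (v y * poly \<rho> y * poly (S * q) y)) = 0"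
        using sum0 by (simp only: sum_negf neg_equal_0_iff_equal)
      ultimately have "\<forall>y\<in>Y \<inter> A. - (v y * poly \<rho> y * poly (S * q) y) = 0"
        using Y by (intro sum_nonneg_eq_0_iff[THEN iffD1]) blast+
      then show ?thesis by (simp only: neg_equal_0_iff_equal)
    qed
    then have "poly S y * poly q y = 0" if "y \<in> Y \<inter> A" for y
      using that pos[OF that] by (metis mult_eq_0_iff order.irrefl poly_mult)
    \<comment> \<open>A node in \<open>A\<close> at which \<open>q\<close> vanishes must come from
      \<open>X\<close>, and \<open>X\<close> consists of zeros of \<open>S\<close>.\<close>
    moreover have "poly S y = 0" if "y \<in> Y \<inter> A" "poly q y = 0" for y
      using that X Y finX by (auto simp: q_def)
    ultimately have "\<forall>y\<in>Y \<inter> A. poly S y = 0" by (metis mult_eq_0_iff)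
    then have "card (Y \<inter> A) \<le> size (roots_in A S)" by (intro card_le_size_roots_in S(1)) auto
    then show ?thesis by simp
  qed
qed

text \<open>The root count is applied to the superlevel sets of \<open>g\<close>, which are
  intervals by assumption. The at most \<open>degree \<rho>\<close> zeros missing in a count are
  each charged with the upper bound \<open>F\<close> of \<open>g\<close> on
  \<open>Y\<close>.\<close>

lemma orthogonal_root_sum_le:
  fixes g :: "real \<Rightarrow> real"
  assumes Y: "finite Y" "card Y = n" "Y \<subseteq> {0<..}" and L: "L = root_poly (mset_set Y)"
    and orth: "\<And>q. degree q < n \<Longrightarrow> I (L * q) = 0"
    and S: "S \<noteq> 0" "degree S \<le> n"
    and \<rho>: "\<And>x. x > 0 \<Longrightarrow> poly \<rho> x > 0"
    and qorth: "\<And>q. degree q + degree \<rho> < n \<Longrightarrow> I (S * (\<rho> * q)) = 0"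
    and g: "\<And>s. is_interval {x. 0 < x \<and> s \<le> g x}" "\<And>x. x > 0 \<Longrightarrow> g x \<ge> 0" "\<And>y. y \<in> Y \<Longrightarrow> g y \<le> F" "F \<ge> 0"
  shows "(\<Sum>y\<in>Y. g y) \<le> (\<Sum>z\<in>#roots_in {0<..} S. g z) + real (degree \<rho>) * F"
proof -
  let ?Z = "roots_in {0<..} S"
  \<comment> \<open>The copies of \<open>F\<close> absorb the defect of the count at every threshold
    up to \<open>F\<close>; above \<open>F\<close> no node contributes.\<close>
  let ?A = "image_mset g ?Z + replicate_mset (degree \<rho>) F"
  let ?B = "image_mset g (mset_set Y)"
  have "sum_mset ?B \<le> sum_mset ?A"
  proof (rule sum_mset_le_if_counts_le)
    show "\<forall>a\<in>#?A. a \<ge> 0" using g S(1) by (auto simp: set_roots_in)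
    fix s
    define C where "C = {x. 0 < x \<and> s \<le> g x}"
    have 1: "size (filter_mset (\<lambda>x. s \<le> x) ?B) = card (Y \<inter> C)"
    proof -
      have "filter_mset (\<lambda>x. s \<le> x) ?B = image_mset g (filter_mset (\<lambda>y. s \<le> g y) (mset_set Y))"
        by (simp add: filter_mset_image_mset)
      then show ?thesis using Y by (simp add: C_def) (intro arg_cong[of _ _ card], auto)
    qed
    have 2: "size (filter_mset (\<lambda>x. s \<le> x) ?A) = size (roots_in C S) + (if s \<le> F then degree \<rho> else 0)"
    proof -
      have "filter_mset (\<lambda>x. s \<le> x) (replicate_mset k F) = (if s \<le> F then replicate_mset k F else {#})" for k
        by (induction k) auto
      then show ?thesis
        by (simp add: filter_mset_image_mset roots_in_def C_def filter_filter_mset conj_commute)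
    qed
    show "size (filter_mset (\<lambda>x. s \<le> x) ?B) \<le> size (filter_mset (\<lambda>x. s \<le> x) ?A)"
    proof (cases "s \<le> F")
      case True
      have "card (Y \<inter> C) \<le> size (roots_in C S) + degree \<rho>"
        by (rule orthogonal_root_count[OF Y(1,2) L orth S \<rho> qorth]) (use g in \<open>auto simp: C_def\<close>)
      then show ?thesis using True 1 2 by simp
    next
      case False
      then have "Y \<inter> C = {}" using g(3) by (force simp: C_def)
      then show ?thesis unfolding 1 by simp
    qed
  qed
  then show ?thesis by (simp add: sum_unfold_sum_mset)
qed

end

section \<open>Laguerre polynomials\<close>

definition laguerre_integral :: "real \<Rightarrow> real poly \<Rightarrow> real" where
  "laguerre_integral \<alpha> p = (LINT x:{0<..}|lborel. poly p x * x powr \<alpha> * exp (- x))"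

lemma laguerre_moment:
  fixes \<alpha> :: real
  assumes "\<alpha> > -1"
  shows "set_integrable lborel {0<..} (\<lambda>x::real. x ^ k * x powr \<alpha> * exp (- x))"
    and "(LINT x:{0<..}|lborel. (x::real) ^ k * x powr \<alpha> * exp (- x)) = Gamma (\<alpha> + 1 + real k)"
proof -
  let ?f = "\<lambda>x. indicator {0<..} x *\<^sub>R (x ^ k * x powr \<alpha> * exp (- x)) :: real"
  have "has_bochner_integral lborel ?f (Gamma (\<alpha> + 1 + real k))"
  proof (rule has_bochner_integral_nn_integral)
    show "?f \<in> borel_measurable lborel" by measurable
    show "AE x in lborel. 0 \<le> ?f x" by (auto simp: indicator_def)
    show "0 \<le> Gamma (\<alpha> + 1 + real k)" using assms by (intro less_imp_le Gamma_real_pos) auto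
    have "(\<integral>\<^sup>+x. ?f x \<partial>lborel)
        = (\<integral>\<^sup>+t. ennreal (indicator {0..} t * t powr ((\<alpha> + 1 + real k) - 1) / exp t) \<partial>lborel)"
    proof (intro nn_integral_cong arg_cong[of _ _ ennreal])
      fix x :: real
      have "x powr (\<alpha> + real k) = x ^ k * x powr \<alpha>" if "x > 0"
        using that by (simp add: powr_add powr_realpow mult.commute)
      then show "?f x = indicator {0..} x * x powr ((\<alpha> + 1 + real k) - 1) / exp x"
        by (cases "x > 0") (auto simp: indicator_def exp_minus field_simps)
    qed
    then show "(\<integral>\<^sup>+x. ?f x \<partial>lborel) = ennreal (Gamma (\<alpha> + 1 + real k))"
      using assms Gamma_conv_nn_integral_real[of "\<alpha> + 1 + real k"] by simp
  qed
  then show "set_integrable lborel {0<..} (\<lambda>x::real. x ^ k * x powr \<alpha> * exp (- x))"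
    and "(LINT x:{0<..}|lborel. (x::real) ^ k * x powr \<alpha> * exp (- x)) = Gamma (\<alpha> + 1 + real k)"
    by (auto simp: set_integrable_def set_lebesgue_integral_def has_bochner_integral_iff)
qed

lemma set_integrable_laguerre:
  fixes \<alpha> :: real and p :: "real poly"
  assumes "\<alpha> > -1"
  shows "set_integrable lborel {0<..} (\<lambda>x. poly p x * x powr \<alpha> * exp (- x))"
proof -
  have "set_integrable lborel {0<..} (\<lambda>x. \<Sum>i\<le>degree p. coeff p i * (x ^ i * x powr \<alpha> * exp (- x)))"
    unfolding set_integrable_def scaleR_sum_right
    by (intro Bochner_Integration.integrable_sum)
       (use set_integrable_mult_right[OF laguerre_moment(1)[OF assms]] in \<open>auto simp: set_integrable_def\<close>)
  then show ?thesis by (simp add: poly_altdef sum_distrib_left sum_distrib_right mult_ac)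
qed

lemma positive_functional_laguerre:
  assumes "\<alpha> > -1"
  shows "positive_functional (laguerre_integral \<alpha>)"
proof
  note int = set_integrable_laguerre[OF assms]
  fix p q :: "real poly" and t :: real
  show "laguerre_integral \<alpha> (p + q) = laguerre_integral \<alpha> p + laguerre_integral \<alpha> q"
    unfolding laguerre_integral_def by (subst set_integral_add(2)[OF int int, symmetric]) (simp add: distrib_right)
  show "laguerre_integral \<alpha> (smult t p) = t * laguerre_integral \<alpha> p"
    unfolding laguerre_integral_def by (subst set_integral_mult_right[symmetric]) (simp add: mult.assoc)
  assume p: "p \<noteq> 0" "\<forall>x>0. poly p x \<ge> 0"
  let ?f = "\<lambda>x. indicator {0<..} x *\<^sub>R (poly p x * x powr \<alpha> * exp (- x)) :: real"
  have f: "integrable lborel ?f" using int by (simp add: set_integrable_def)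
  have nn: "AE x in lborel. 0 \<le> ?f x" using p by (auto simp: indicator_def)
  have "integral\<^sup>L lborel ?f \<noteq> 0"
  proof
    assume "integral\<^sup>L lborel ?f = 0"
    then have "AE x in lborel. ?f x = 0" using integral_nonneg_eq_0_iff_AE[OF f nn] by simp
    moreover have "AE x in lborel. x \<notin> {x. poly p x = 0}"
      using poly_roots_finite[OF p(1)] by (intro AE_not_in finite_imp_null_set_lborel) auto
    ultimately have "AE x in lborel. x \<notin> {0<..(1::real)}"
      by eventually_elim (auto simp: indicator_def split: if_splits)
    then have "emeasure lborel {0<..(1::real)} = 0"
      by (subst (asm) AE_iff_measurable[of "{0<..1}"]) auto
    then show False by simp
  qed
  then show "laguerre_integral \<alpha> p > 0"
    using integral_nonneg_AE[OF nn] by (simp add: laguerre_integral_def set_lebesgue_integral_def)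
qed

lemma laguerre_integral_monom:
  assumes "\<alpha> > -1"
  shows "laguerre_integral \<alpha> (monom 1 k) = Gamma (\<alpha> + 1) * pochhammer (\<alpha> + 1) k"
proof -
  have "pochhammer (\<alpha> + 1) k = Gamma (\<alpha> + 1 + of_nat k) / Gamma (\<alpha> + 1)"
    using assms by (intro pochhammer_Gamma) (auto elim!: nonpos_Ints_cases)
  moreover have "Gamma (\<alpha> + 1) > 0" using assms by (intro Gamma_real_pos) auto
  ultimately show ?thesis
    using laguerre_moment(2)[OF assms, of k] by (simp add: laguerre_integral_def poly_monom field_simps)
qed

text \<open>The monic Laguerre polynomial: (-1)^n n! times the classical one with parameter a -
  1.\<close>

definition laguerre :: "real \<Rightarrow> nat \<Rightarrow> real poly" where
  "laguerre a n = (\<Sum>k\<le>n. monom ((-1) ^ (n - k) * real (n choose k) * pochhammer (a + real k) (n - k)) k)"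

lemma coeff_laguerre:
  "coeff (laguerre a n) k = (if k \<le> n then (-1) ^ (n - k) * real (n choose k) * pochhammer (a + real k) (n - k) else 0)"
  by (simp add: laguerre_def coeff_sum coeff_monom if_distrib sum.delta cong: if_cong)

lemma degree_laguerre [simp]: "degree (laguerre a n) = n"
  by (intro antisym degree_le le_degree) (auto simp: coeff_laguerre)

lemma lead_coeff_laguerre [simp]: "coeff (laguerre a n) n = 1"
  by (simp add: coeff_laguerre)

text \<open>Up to sign this is the n-th finite difference in a of \<open>pochhammer a j\<close>, a
  monic polynomial of degree j in a. It vanishes for j < n and equals n! up to sign for j =
  n.\<close>

lemma alternating_sum_pochhammer:
  fixes a :: real
  shows "j < n \<Longrightarrow> (\<Sum>k\<le>n. (-1) ^ k * real (n choose k) * pochhammer (a + real k) j) = 0"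
    and "(\<Sum>k\<le>n. (-1) ^ k * real (n choose k) * pochhammer (a + real k) n) = (-1) ^ n * fact n"
proof -
  define F where "F n j a = (\<Sum>k\<le>n. (-1) ^ k * real (n choose k) * pochhammer (a + real k) j)" for n j and a :: real
  have step: "F (Suc n) j a = F n j a - F n j (a + 1)" for n j a
  proof -
    have "F (Suc n) j a = pochhammer a j
        + (\<Sum>k\<le>n. (-1) ^ Suc k * real (Suc n choose Suc k) * pochhammer (a + real (Suc k)) j)"
      unfolding F_def by (subst sum.atMost_Suc_shift) simp
    also have "(\<Sum>k\<le>n. (-1) ^ Suc k * real (Suc n choose Suc k) * pochhammer (a + real (Suc k)) j)
        = (\<Sum>k\<le>n. (-1) ^ Suc k * real (n choose Suc k) * pochhammer (a + real (Suc k)) j)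
          - F n j (a + 1)"
      unfolding F_def sum_subtractf[symmetric]
      by (intro sum.cong) (auto simp: algebra_simps)
    also have "pochhammer a j + ((\<Sum>k\<le>n. (-1) ^ Suc k * real (n choose Suc k) * pochhammer (a + real (Suc k)) j)
          - F n j (a + 1)) = (\<Sum>k\<le>Suc n. (-1) ^ k * real (n choose k) * pochhammer (a + real k) j) - F n j (a + 1)"
      by (subst sum.atMost_Suc_shift) simp
    also have "(\<Sum>k\<le>Suc n. (-1) ^ k * real (n choose k) * pochhammer (a + real k) j) = F n j a"
      by (simp add: F_def)
    finally show ?thesis .
  qed
  have poch: "pochhammer a (Suc j) - pochhammer (a + 1) (Suc j) = - real (Suc j) * pochhammer (a + 1) j" for a :: real and j
    by (subst pochhammer_rec, subst pochhammer_rec') (simp add: algebra_simps)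
  have step2: "F (Suc n) (Suc j) a = - real (Suc j) * F n j (a + 1)" for n j a
  proof -
    have "F n (Suc j) a - F n (Suc j) (a + 1)
       = (\<Sum>k\<le>n. (-1) ^ k * real (n choose k) * (pochhammer (a + real k) (Suc j) - pochhammer (a + real k + 1) (Suc j)))"
      unfolding F_def by (simp add: sum_subtractf[symmetric] algebra_simps)
    also have "\<dots> = - real (Suc j) * F n j (a + 1)"
      unfolding poch F_def sum_distrib_left by (intro sum.cong) (auto simp: algebra_simps)
    finally show ?thesis unfolding step .
  qed
  have "j < n \<Longrightarrow> F n j a = 0" for n j a
  proof (induction n arbitrary: j a)
    case (Suc n)
    show ?case
    proof (cases j)
      case 0
      have "F n 0 a = F n 0 (a + 1)" for a by (simp add: F_def)
      then show ?thesis using 0 step by simp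
    next
      case (Suc i)
      then show ?thesis using Suc.IH[of i] Suc.prems step2 by simp
    qed
  qed simp
  then show "j < n \<Longrightarrow> (\<Sum>k\<le>n. (-1) ^ k * real (n choose k) * pochhammer (a + real k) j) = 0"
    by (simp add: F_def)
  have "F n n a = (-1) ^ n * fact n" for n a
  proof (induction n arbitrary: a)
    case 0
    then show ?case by (simp add: F_def)
  next
    case (Suc n)
    show ?case unfolding step2 Suc.IH by (simp add: algebra_simps)
  qed
  then show "(\<Sum>k\<le>n. (-1) ^ k * real (n choose k) * pochhammer (a + real k) n) = (-1) ^ n * fact n"
    by (simp add: F_def)
qed

lemma minus_one_power_diff:
  assumes "k \<le> n"
  shows "(-1) ^ (n - k) = ((-1) ^ n * (-1) ^ k :: real)"
proof -
  obtain m where "n = k + m" using assms by (auto simp: le_iff_add)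
  then show ?thesis by (simp add: power_add)
qed

text \<open>For a > 0 and t > 0 all terms at -t have the same sign, so there is no cancellation and
  any single term is a lower bound.\<close>

lemma poly_laguerre_neg:
  "(-1) ^ n * poly (laguerre a n) (- t) = (\<Sum>k\<le>n. real (n choose k) * pochhammer (a + real k) (n - k) * t ^ k)"
  "(-1) ^ n * poly (pderiv (laguerre a n)) (- t) = - (\<Sum>k\<le>n. real k * (real (n choose k) * pochhammer (a + real k) (n - k) * t ^ (k - 1)))"
proof -
  have sgn: "(-1) ^ n * ((-1) ^ (n - k) * (-1) ^ k) = (1::real)" if "k \<le> n" for k
  proof -
    have sq: "(-1) ^ m * (-1) ^ m = (1::real)" for m by (simp flip: power_mult_distrib)
    have "(-1) ^ n * ((-1) ^ (n - k) * (-1) ^ k) = ((-1) ^ n * (-1) ^ n) * ((-1) ^ k * (-1) ^ k :: real)"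
      unfolding minus_one_power_diff[OF that] by (simp only: mult.assoc)
    then show ?thesis by (simp only: sq mult_1_left)
  qed
  show "(-1) ^ n * poly (laguerre a n) (- t) = (\<Sum>k\<le>n. real (n choose k) * pochhammer (a + real k) (n - k) * t ^ k)"
    unfolding laguerre_def poly_sum sum_distrib_left poly_monom
  proof (rule sum.cong[OF refl])
    fix k assume k: "k \<in> {..n}"
    have "(-1) ^ n * ((-1) ^ (n - k) * real (n choose k) * pochhammer (a + real k) (n - k) * (- t) ^ k)
       = ((-1) ^ n * ((-1) ^ (n - k) * (-1) ^ k)) * (real (n choose k) * pochhammer (a + real k) (n - k) * t ^ k)"
      unfolding power_minus[of t k] by (simp only: ac_simps)
    also have "\<dots> = real (n choose k) * pochhammer (a + real k) (n - k) * t ^ k"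
      using sgn[of k] k by (simp only: atMost_iff mult_1_left)
    finally show "(-1) ^ n * ((-1) ^ (n - k) * real (n choose k) * pochhammer (a + real k) (n - k) * (- t) ^ k)
       = real (n choose k) * pochhammer (a + real k) (n - k) * t ^ k" .
  qed
  show "(-1) ^ n * poly (pderiv (laguerre a n)) (- t) = - (\<Sum>k\<le>n. real k * (real (n choose k) * pochhammer (a + real k) (n - k) * t ^ (k - 1)))"
    unfolding laguerre_def higher_pderiv_sum[of 1, simplified] poly_sum sum_distrib_left pderiv_monom poly_monom sum_negf[symmetric]
  proof (rule sum.cong[OF refl])
    fix k assume k: "k \<in> {..n}"
    show "(-1) ^ n * (of_nat k * ((-1) ^ (n - k) * real (n choose k) * pochhammer (a + real k) (n - k)) * (- t) ^ (k - 1))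
       = - (real k * (real (n choose k) * pochhammer (a + real k) (n - k) * t ^ (k - 1)))"
    proof (cases k)
      case (Suc i)
      have "(-1) ^ n * (of_nat k * ((-1) ^ (n - k) * real (n choose k) * pochhammer (a + real k) (n - k)) * (- t) ^ (k - 1))
         = - ((-1) ^ n * ((-1) ^ (n - k) * (-1) ^ k)) * (real k * (real (n choose k) * pochhammer (a + real k) (n - k) * t ^ (k - 1)))"
        unfolding power_minus[of t "k - 1"] by (simp add: Suc ac_simps)
      then show ?thesis using sgn k by simp
    qed simp
  qed
qed

lemma pochhammer_split: 
  fixes a :: real
  assumes "k \<le> n"
  shows "pochhammer a n = pochhammer a k * pochhammer (a + real k) (n - k)"
  using pochhammer_product[of k n a] assms by simp

text \<open>One term of the expansion is kept. The index \<open>k\<close> is free, and for fixed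
  \<open>k\<close> the binomial coefficient grows like the k-th power of n.\<close>

lemma abs_poly_laguerre_lower_bound:
  assumes "a > 0" "t > 0" "k \<le> n"
  shows "\<bar>poly (laguerre a n) (- t)\<bar> \<ge> real (n choose k) * (pochhammer a n / pochhammer a k) * t ^ k"
proof -
  have "real (n choose k) * pochhammer (a + real k) (n - k) * t ^ k
      \<le> (\<Sum>k\<le>n. real (n choose k) * pochhammer (a + real k) (n - k) * t ^ k)"
    using assms by (intro member_le_sum) (auto intro!: mult_nonneg_nonneg pochhammer_nonneg)
  also have "\<dots> = (-1) ^ n * poly (laguerre a n) (- t)" by (simp add: poly_laguerre_neg)
  also have "\<dots> \<le> \<bar>\<dots>\<bar>" by simp
  also have "\<dots> = \<bar>poly (laguerre a n) (- t)\<bar>" by (simp add: abs_mult)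
  finally show ?thesis
    using pochhammer_split[OF assms(3), of a] pochhammer_pos[OF assms(1), of k] by simp
qed

text \<open>At -t, the quantity t |L'| / |L| is the mean of k with respect to the weights
  \<open>A k\<close>. For large n these at least double at each step up to \<open>M\<close>, so at
  least half of the total weight sits at indices k \<ge> M and the mean is at least M / 2.\<close>

lemma laguerre_log_deriv_lower_bound:
  assumes a: "a > 0" and t: "t > 0" and n: "real n \<ge> real M + 2 * real M * (a + real M) / t"
  shows "real M * \<bar>poly (laguerre a n) (- t)\<bar> \<le> 2 * t * \<bar>poly (pderiv (laguerre a n)) (- t)\<bar>"
proof -
  define A where "A k = real (n choose k) * pochhammer (a + real k) (n - k) * t ^ k" for k
  have A0: "A k \<ge> 0" for k using a t by (auto simp: A_def intro!: mult_nonneg_nonneg pochhammer_nonneg)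
  have Mn: "M \<le> n"
  proof -
    have "2 * real M * (a + real M) / t \<ge> 0" using a t by auto
    then show ?thesis using n by linarith
  qed
  \<comment> \<open>The quotient of consecutive terms is (n - k) t / ((k + 1) (a + k)); the assumed
    lower bound on n is what makes it at least 2 for all k < M.\<close>
  have grow: "2 * A k \<le> A (Suc k)" if "k < M" for k
  proof -
    have kn: "k < n" using that Mn by simp
    have 1: "pochhammer (a + real k) (n - k) = (a + real k) * pochhammer (a + real (Suc k)) (n - Suc k)"
      using kn by (subst Suc_diff_Suc[symmetric]) (simp_all add: pochhammer_rec add_ac)
    have 2: "real (Suc k) * real (n choose Suc k) = real (n - k) * real (n choose k)"
      by (metis binomial_absorb_comp binomial_absorption of_nat_mult)
    have "2 * real (Suc k) * (a + real k) \<le> 2 * real M * (a + real M)"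
      using that a by (intro mult_mono) auto
    also have "\<dots> \<le> real (n - k) * t" 
    proof -
      have "2 * real M * (a + real M) / t \<le> real (n - k)" using n that Mn by (simp add: of_nat_diff)
      then show ?thesis using t by (simp add: field_simps)
    qed
    finally have 3: "2 * real (Suc k) * (a + real k) \<le> real (n - k) * t" .
    define C where "C = real (n choose k) * pochhammer (a + real (Suc k)) (n - Suc k) * t ^ k"
    have "C \<ge> 0" using a t unfolding C_def by (auto intro!: mult_nonneg_nonneg pochhammer_nonneg)
    have "real (Suc k) * (2 * A k) = 2 * real (Suc k) * (a + real k) * C"
      by (simp add: A_def C_def 1 mult_ac)
    also have "\<dots> \<le> real (n - k) * t * C" by (intro mult_right_mono 3 \<open>C \<ge> 0\<close>)
    also have "\<dots> = (real (n - k) * real (n choose k)) * (pochhammer (a + real (Suc k)) (n - Suc k) * t ^ Suc k)"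
      by (simp add: C_def mult_ac)
    also have "\<dots> = real (Suc k) * A (Suc k)" unfolding 2[symmetric] by (simp add: A_def mult_ac)
    finally show ?thesis by simp
  qed
  have small: "k \<le> M \<Longrightarrow> (\<Sum>j<k. A j) \<le> A k" for k
  proof (induction k)
    case (Suc k)
    then show ?case using grow[of k] by simp
  qed (simp add: A0)
  have L: "\<bar>poly (laguerre a n) (- t)\<bar> = (\<Sum>k\<le>n. A k)"
  proof -
    have "(-1) ^ n * poly (laguerre a n) (- t) = (\<Sum>k\<le>n. A k)" by (simp add: poly_laguerre_neg A_def)
    then have "\<bar>(-1) ^ n * poly (laguerre a n) (- t)\<bar> = (\<Sum>k\<le>n. A k)" by (simp add: sum_nonneg A0)
    then show ?thesis by (simp add: abs_mult)
  qed
  have L': "t * \<bar>poly (pderiv (laguerre a n)) (- t)\<bar> = (\<Sum>k\<le>n. real k * A k)"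
  proof -
    have "t * ((-1) ^ n * poly (pderiv (laguerre a n)) (- t)) = - (\<Sum>k\<le>n. real k * A k)"
      unfolding poly_laguerre_neg A_def mult_minus_right sum_distrib_left neg_equal_iff_equal
    proof (rule sum.cong[OF refl])
      show "t * (real k * (real (n choose k) * pochhammer (a + real k) (n - k) * t ^ (k - 1)))
        = real k * (real (n choose k) * pochhammer (a + real k) (n - k) * t ^ k)" for k
        by (cases k) simp_all
    qed
    then have "\<bar>t * ((-1) ^ n * poly (pderiv (laguerre a n)) (- t))\<bar> = \<bar>\<Sum>k\<le>n. real k * A k\<bar>" by simp
    then show ?thesis using t by (simp add: abs_mult sum_nonneg A0)
  qed
  have split: "(\<Sum>k\<le>n. A k) = (\<Sum>k<M. A k) + (\<Sum>k=M..n. A k)"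
    using Mn by (metis atLeast0AtMost atLeast0LessThan le_SucI lessThan_Suc_atMost sum.atLeastLessThan_concat zero_le atLeastLessThanSuc_atLeastAtMost)
  have "(\<Sum>k<M. A k) \<le> (\<Sum>k=M..n. A k)"
  proof -
    have "A M \<le> (\<Sum>k=M..n. A k)" using Mn A0 by (intro member_le_sum) auto
    then show ?thesis using small[of M] by simp
  qed
  then have "real M * (\<Sum>k\<le>n. A k) \<le> 2 * (\<Sum>k=M..n. real M * A k)"
    unfolding split sum_distrib_left[symmetric] using mult_left_mono[of _ _ "real M"] by (fastforce simp: algebra_simps)
  also have "(\<Sum>k=M..n. real M * A k) \<le> (\<Sum>k=M..n. real k * A k)"
    by (intro sum_mono mult_right_mono A0) auto
  also have "\<dots> \<le> (\<Sum>k\<le>n. real k * A k)" by (intro sum_mono2) (auto simp: A0)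
  finally show ?thesis unfolding L using L' by simp
qed

section \<open>Laguerre polynomials through the moments of the weight\<close>

locale laguerre_functional = positive_functional +
  fixes a :: real
  assumes a_pos: "a > 0"
    and moment: "I (monom 1 k) = Gamma a * pochhammer a k"
begin

text \<open>The moment of order k + j contains the factor \<open>pochhammer a k\<close>, which
  completes the k-th coefficient to \<open>pochhammer a n\<close>. This no longer depends on k, and
  a finite difference remains.\<close>

lemma I_laguerre_monom:
  "I (laguerre a n * monom 1 j) = (-1) ^ n * (Gamma a * pochhammer a n) * 
      (\<Sum>k\<le>n. (-1) ^ k * real (n choose k) * pochhammer (a + real k) j)"
proof -
  have "I (laguerre a n * monom 1 j) = (\<Sum>k\<le>n. (-1) ^ (n - k) * real (n choose k) * pochhammer (a + real k) (n - k) * I (monom 1 (k + j)))"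
    unfolding laguerre_def sum_distrib_right I_sum mult_monom
    by (intro sum.cong refl) (metis I_smult mult.right_neutral smult_monom)
  also have "\<dots> = (\<Sum>k\<le>n. (-1) ^ n * (Gamma a * pochhammer a n) * ((-1) ^ k * real (n choose k) * pochhammer (a + real k) j))"
  proof (rule sum.cong[OF refl])
    fix k assume k: "k \<in> {..n}"
    have "pochhammer a (k + j) = pochhammer a k * pochhammer (a + real k) j"
      using pochhammer_split[of k "k + j" a] by simp
    moreover have "pochhammer a n = pochhammer a k * pochhammer (a + real k) (n - k)"
      using k by (intro pochhammer_split) auto
    moreover have "(-1) ^ (n - k) = (-1) ^ n * ((-1) ^ k :: real)"
      using k by (intro minus_one_power_diff) auto
    ultimately show "(-1) ^ (n - k) * real (n choose k) * pochhammer (a + real k) (n - k) * I (monom 1 (k + j))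
      = (-1) ^ n * (Gamma a * pochhammer a n) * ((-1) ^ k * real (n choose k) * pochhammer (a + real k) j)"
      by (simp add: moment mult_ac)
  qed
  finally show ?thesis by (simp add: sum_distrib_left)
qed

lemma laguerre_orth:
  assumes "degree q < n"
  shows "I (laguerre a n * q) = 0"
proof -
  have "I (laguerre a n * q) = (\<Sum>i<n. coeff q i * I (laguerre a n * monom 1 i))"
    by (subst poly_eq_sum_monom_less[OF assms]) (simp only: sum_distrib_left I_sum mult_smult_right I_smult)
  also have "\<dots> = 0" by (intro sum.neutral ballI) (simp add: I_laguerre_monom alternating_sum_pochhammer(1))
  finally show ?thesis .
qed

lemma laguerre_norm: "I (laguerre a n * laguerre a n) = Gamma a * pochhammer a n * fact n"
proof -
  have "I (laguerre a n * monom 1 n) = Gamma a * pochhammer a n * fact n"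
    unfolding I_laguerre_monom alternating_sum_pochhammer(2) by (simp flip: power_add)
  moreover have "laguerre a n = monom 1 n \<or> degree (laguerre a n - monom 1 n) < n"
    by (rule monic_diff_cases) (auto simp: degree_monom_eq)
  moreover have "I (laguerre a n * laguerre a n) = I (laguerre a n * monom 1 n) + I (laguerre a n * (laguerre a n - monom 1 n))"
    by (simp add: I_add[symmetric] algebra_simps)
  ultimately show ?thesis using laguerre_orth by fastforce
qed

text \<open>The zeros are positive, so each is at most their sum, which Vieta reads off the second
  coefficient. A polynomial bound in n is all that is asked of it.\<close>

lemma laguerre_roots:
  obtains Y where "finite Y" "Y \<subseteq> {0<..}" "card Y = n" "laguerre a n = root_poly (mset_set Y)"
    "\<And>y. y \<in> Y \<Longrightarrow> y \<le> real n * (a + real n)"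
proof -
  obtain Y where Y: "finite Y" "Y \<subseteq> {0<..}" "card Y = n" "laguerre a n = root_poly (mset_set Y)"
    by (rule orthogonal_roots[of "laguerre a n" n]) (auto intro: laguerre_orth)
  have vieta: "coeff (root_poly A) (size A - 1) = - sum_mset A" if "A \<noteq> {#}" for A
    using that
  proof (induction A)
    case (add x A)
    show ?case
    proof (cases "A = {#}")
      case False
      then obtain k where k: "size A = Suc k" by (metis size_eq_0_iff_empty old.nat.exhaust)
      have "coeff (root_poly A) (Suc k) = 1" using lead_coeff_root_poly[of A] k by simp
      then show ?thesis using add.IH[OF False] k by simp
    qed simp
  qed simp
  have "y \<le> real n * (a + real n)" if "y \<in> Y" for y
  proof -
    have n: "n \<ge> 1" using that Y(1,3) by (metis One_nat_def Suc_leI card_gt_0_iff empty_iff)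
    have "y \<le> (\<Sum>y\<in>Y. y)" using that Y by (intro member_le_sum) (auto dest: less_imp_le)
    also have "\<dots> = - coeff (laguerre a n) (n - 1)"
    proof -
      have "mset_set Y \<noteq> {#}" using that Y by (auto simp: mset_set_empty_iff)
      then show ?thesis unfolding Y(4) using vieta[of "mset_set Y"] Y(3) by (simp add: sum_unfold_sum_mset)
    qed
    also have "\<dots> = real n * (a + real n - 1)"
      using n by (cases n) (simp_all add: coeff_laguerre algebra_simps)
    also have "\<dots> \<le> real n * (a + real n)" by (intro mult_left_mono) auto
    finally show ?thesis .
  qed
  then show ?thesis using that Y by blast
qed

end

section \<open>Discrete Sobolev inner products\<close>

text \<open>Sequential ordering enters only as \<open>c_ordered\<close>: points with derivatives of
  higher order lie further to the left. It is derived in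
  \<open>sequentially_ordered_imp\<close>.\<close>

locale discrete_sobolev = positive_functional +
  fixes N :: nat and w c :: "nat \<Rightarrow> real" and d :: "nat \<Rightarrow> nat"
  assumes w_pos: "j \<in> {1..N} \<Longrightarrow> w j > 0"
    and c_neg: "j \<in> {1..N} \<Longrightarrow> c j < 0"
    and c_inj: "inj_on c {1..N}"
    and c_ordered: "i \<in> {1..N} \<Longrightarrow> j \<in> {1..N} \<Longrightarrow> d i < d j \<Longrightarrow> c j < c i"
begin

definition B :: "real poly \<Rightarrow> real poly \<Rightarrow> real" where
  "B f g = I (f * g) + (\<Sum>j=1..N. w j * poly ((pderiv ^^ d j) f) (c j) * poly ((pderiv ^^ d j) g) (c j))"

sublocale poly_inner B
proof
  fix p p' q :: "real poly" and t :: real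
  show "B p q = B q p" by (simp add: B_def mult.commute mult.left_commute)
  show "B (p + p') q = B p q + B p' q"
    by (simp add: B_def distrib_right I_add higher_pderiv_add sum.distrib algebra_simps)
  show "B (smult t p) q = t * B p q"
    by (simp add: B_def I_smult higher_pderiv_smult sum_distrib_left algebra_simps)
  assume "p \<noteq> 0"
  then have "I (p * p) > 0" by (intro I_pos) auto
  moreover have "(\<Sum>j=1..N. w j * poly ((pderiv ^^ d j) p) (c j) * poly ((pderiv ^^ d j) p) (c j)) \<ge> 0"
    unfolding mult.assoc by (intro sum_nonneg mult_nonneg_nonneg[OF less_imp_le[OF w_pos] zero_le_square])
  ultimately show "B p p > 0" by (simp add: B_def)
qed

definition \<rho> :: "real poly" where
  "\<rho> = (\<Prod>j=1..N. [:- c j, 1:] ^ Suc (d j))"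

definition D :: nat where
  "D = (\<Sum>j=1..N. Suc (d j))"

lemma degree_\<rho>: "degree \<rho> = D"
  unfolding \<rho>_def D_def by (subst degree_prod_eq_sum_degree) (simp_all add: degree_linear_power del: power_Suc)

lemma lead_coeff_\<rho>: "lead_coeff \<rho> = 1"
  unfolding \<rho>_def lead_coeff_prod by (intro prod.neutral) (simp add: lead_coeff_power del: power_Suc)

lemma poly_\<rho>_pos: "x > 0 \<Longrightarrow> poly \<rho> x > 0"
  unfolding \<rho>_def poly_prod using c_neg
  by (intro prod_pos) (fastforce simp del: power_Suc intro!: zero_less_power)

lemma \<rho>_nonzero: "\<rho> \<noteq> 0"
  using lead_coeff_\<rho> by auto

lemma d_le_D: "j \<in> {1..N} \<Longrightarrow> d j \<le> D"
  unfolding D_def using member_le_sum[of j "{1..N}" "\<lambda>j. Suc (d j)"] by auto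

lemma B_\<rho>_mult: "B (\<rho> * q) f = I (f * (\<rho> * q))"
proof -
  have "poly ((pderiv ^^ d j) (\<rho> * q)) (c j) = 0" if "j \<in> {1..N}" for j
  proof -
    have "[:- c j, 1:] ^ Suc (d j) dvd \<rho>"
      unfolding \<rho>_def using that by (intro dvd_prodI) auto
    then have "[:- c j, 1:] ^ Suc (d j) dvd \<rho> * q" by (rule dvd_mult2)
    then show ?thesis by (simp add: higher_pderiv_eq_taylor_coeff taylor_coeff_eq_0_if_dvd del: power_Suc)
  qed
  then show ?thesis by (simp add: B_def mult.commute)
qed

lemma is_orth_quasi:
  assumes "is_orth n S" "degree q + degree \<rho> < n"
  shows "I (S * (\<rho> * q)) = 0"
proof -
  have "degree (\<rho> * q) < n" using degree_mult_le[of \<rho> q] assms(2) by linarith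
  then show ?thesis using is_orth_low_degree[OF assms(1)] B_\<rho>_mult by metis
qed

lemma is_orth_many_odd_roots:
  assumes S: "is_orth n S" and n: "n \<ge> 2 * D"
  shows "n \<le> card (odd_roots_in {0<..} S) + N"
proof (rule ccontr)
  define X where "X = odd_roots_in {0<..} S"
  define P where "P = root_poly (mset_set X)"
  assume "\<not> n \<le> card (odd_roots_in {0<..} S) + N"
  then have less: "card X + N < n" by (simp add: X_def)
  have S0: "S \<noteq> 0" using S by (auto simp: is_orth_def)
  have finX: "finite X" unfolding X_def by (rule finite_odd_roots_in[OF S0])
  have X: "X \<subseteq> {x\<in>{0<..}. poly S x = 0}" unfolding X_def by (rule odd_roots_in_subset)
  have P0: "P \<noteq> 0" and degP: "degree P = card X" by (simp_all add: P_def)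
  have nz: "I (S * P * r) \<noteq> 0" if "r \<noteq> 0" "\<forall>x\<in>{0<..}. poly r x \<noteq> 0" for r
    unfolding P_def X_def using that S0
    by (intro I_nonzero_if_constant_sign constant_sign_mult_odd_roots is_interval_pos) auto
  \<comment> \<open>This crude count, from the test polynomial \<open>\<rho> * P\<close>, comes
    before the sharp one: together with n \<ge> 2 D it supplies the D positive zeros without which
    the Rolle count does not apply.\<close>
  have "card X \<ge> n - D"
  proof (rule ccontr)
    assume "\<not> card X \<ge> n - D"
    then have "I (S * (\<rho> * P)) = 0" by (intro is_orth_quasi[OF S]) (simp add: degree_\<rho> degP)
    moreover have "I (S * P * \<rho>) \<noteq> 0"
      using poly_\<rho>_pos by (intro nz \<rho>_nonzero) (metis greaterThan_iff less_irrefl)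
    ultimately show False by (simp add: mult_ac)
  qed
  then have XD: "D \<le> card X" using n by simp
  \<comment> \<open>N + 1 coefficients against N conditions: some nonzero \<open>h\<close> of degree
    at most N makes \<open>P * h\<close> invisible to the discrete part of the inner
    product.\<close>
  obtain x where x: "\<exists>j\<in>{..N}. x j \<noteq> 0"
      "\<forall>i\<in>{1..N}. (\<Sum>j\<in>{..N}. poly ((pderiv ^^ d i) (P * monom 1 j)) (c i) * x j) = 0"
    using underdetermined_system_nontrivial[of "{1..N}" "{..N}" "\<lambda>i j. poly ((pderiv ^^ d i) (P * monom 1 j)) (c i)"] by auto
  define h where "h = (\<Sum>j\<le>N. smult (x j) (monom 1 j))"
  have ch: "coeff h j = (if j \<le> N then x j else 0)" for j
    by (simp add: h_def coeff_sum coeff_monom if_distrib sum.delta cong: if_cong)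
  have h0: "h \<noteq> 0" using x(1) ch by (metis atMost_iff coeff_0)
  have degh: "degree h \<le> N" by (rule degree_le) (simp add: ch)
  have cond: "poly ((pderiv ^^ d i) (P * h)) (c i) = 0" if "i \<in> {1..N}" for i
    using x(2) that
    by (simp add: h_def sum_distrib_left higher_pderiv_sum poly_sum higher_pderiv_smult mult.commute)
  have f0: "P * h \<noteq> 0" using P0 h0 by simp
  have rP: "roots_in {0<..} P = mset_set X"
  proof -
    have "filter_mset (\<lambda>x. x \<in> {0<..}) (mset_set X) = mset_set X"
      using X finX by (intro filter_mset_eq_conv[THEN iffD2]) auto
    then show ?thesis by (simp add: roots_in_def P_def)
  qed
  have size: "size (roots_in {0<..} (P * h)) = card X + size (roots_in {0<..} h)"
    using rP f0 by (simp add: roots_in_def proots_mult)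
  \<comment> \<open>The N conditions use up the whole degree that \<open>h\<close> can add, so
    \<open>h\<close> has no positive zero and does not disturb the constant sign of
    \<open>S * P\<close>.\<close>
  have "size (roots_in {0<..} (P * h)) + card {1..N} \<le> degree (P * h)"
    by (rule degree_ge_if_sequential_conditions[where c = c and d = d and K = D])
       (use c_inj c_neg c_ordered d_le_D f0 cond XD size in auto)
  also have "degree (P * h) \<le> card X + N" using degree_mult_le[of P h] degh degP by linarith
  finally have "size (roots_in {0<..} h) = 0" using size by simp
  then have "\<forall>x\<in>{0<..}. poly h x \<noteq> 0" using set_roots_in[OF h0, of "{0<..}"] by auto
  then have "I (S * P * h) \<noteq> 0" using h0 by (intro nz) auto
  moreover have "B (P * h) S = 0"
    by (rule is_orth_low_degree[OF S]) (use degree_mult_le[of P h] degh degP less in linarith)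
  moreover have "B (P * h) S = I (P * h * S)" using cond by (simp add: B_def)
  ultimately show False by (simp add: mult_ac)
qed

end

section \<open>Perturbation of monic polynomials\<close>

definition coeff_norm :: "nat \<Rightarrow> real poly \<Rightarrow> real" where
  "coeff_norm N p = (\<Sum>j\<le>N. \<bar>coeff p j\<bar>)"

lemma coeff_norm_nonneg [simp]: "coeff_norm N p \<ge> 0"
  by (simp add: coeff_norm_def sum_nonneg)

lemma coeff_norm_triangle: "coeff_norm N (p + q) \<le> coeff_norm N p + coeff_norm N q"
  by (simp add: coeff_norm_def sum.distrib[symmetric] sum_mono abs_triangle_ineq)

text \<open>Lagrange interpolation, with a constant that depends only on the nodes and on
  \<open>N\<close>.\<close>

lemma coeff_norm_interpolation_bound:
  assumes "finite X"
  shows "\<exists>C\<ge>0. \<forall>p. degree p < card X \<longrightarrow> coeff_norm N p \<le> C * (\<Sum>x\<in>X. \<bar>poly p x\<bar>)"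
proof -
  define Q where "Q y = root_poly (mset_set (X - {y}))" for y
  define l where "l y = smult (1 / poly (Q y) y) (Q y)" for y
  have l: "poly (l y) x = (if x = y then 1 else 0)" if "x \<in> X" "y \<in> X" for x y
    using that assms by (auto simp: l_def Q_def)
  define C where "C = (\<Sum>x\<in>X. coeff_norm N (l x))"
  have "coeff_norm N p \<le> C * (\<Sum>x\<in>X. \<bar>poly p x\<bar>)" if p: "degree p < card X" for p
  proof -
    have "p = (\<Sum>x\<in>X. smult (poly p x) (l x))"
    proof (rule poly_eqI_degree[of X])
      show "poly p x = poly (\<Sum>x\<in>X. smult (poly p x) (l x)) x" if "x \<in> X" for x
        using that assms by (simp add: poly_sum l if_distrib sum.delta' cong: if_cong)
      have "degree (smult (poly p x) (l x)) \<le> card X - 1" if "x \<in> X" for x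
        using that assms by (auto simp: l_def Q_def)
      then have "degree (\<Sum>x\<in>X. smult (poly p x) (l x)) \<le> card X - 1"
        using assms by (intro degree_sum_le) auto
      then show "degree (\<Sum>x\<in>X. smult (poly p x) (l x)) < card X" using p by linarith
    qed (rule p)
    then have "coeff p j = (\<Sum>x\<in>X. poly p x * coeff (l x) j)" for j
      by (metis (no_types, lifting) coeff_smult coeff_sum sum.cong)
    then have "coeff_norm N p \<le> (\<Sum>j\<le>N. \<Sum>x\<in>X. \<bar>poly p x\<bar> * \<bar>coeff (l x) j\<bar>)"
      unfolding coeff_norm_def by (intro sum_mono) (simp add: abs_mult[symmetric] sum_abs)
    also have "\<dots> = (\<Sum>x\<in>X. \<bar>poly p x\<bar> * coeff_norm N (l x))"
      by (subst sum.swap) (simp add: sum_distrib_left coeff_norm_def)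
    also have "\<dots> \<le> (\<Sum>x\<in>X. \<bar>poly p x\<bar> * C)"
      unfolding C_def using assms by (intro sum_mono mult_left_mono member_le_sum) auto
    finally show ?thesis by (subst mult.commute) (simp only: sum_distrib_right)
  qed
  moreover have "C \<ge> 0" by (simp add: C_def sum_nonneg)
  ultimately show ?thesis by blast
qed

lemma abs_poly_le_coeff_norm:
  assumes "degree p \<le> N"
  shows "\<bar>poly p t\<bar> \<le> coeff_norm N p * (\<Sum>j\<le>N. \<bar>t\<bar> ^ j)"
proof -
  have "poly p t = (\<Sum>j\<le>N. coeff p j * t ^ j)"
    unfolding poly_altdef using assms by (intro sum.mono_neutral_left) (auto simp: coeff_eq_0)
  then have "\<bar>poly p t\<bar> \<le> (\<Sum>j\<le>N. \<bar>coeff p j\<bar> * \<bar>t\<bar> ^ j)"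
    by (simp add: abs_mult[symmetric] power_abs[symmetric] sum_abs)
  also have "\<dots> \<le> (\<Sum>j\<le>N. \<bar>coeff p j\<bar> * (\<Sum>j\<le>N. \<bar>t\<bar> ^ j))"
    by (intro sum_mono mult_left_mono member_le_sum) auto
  finally show ?thesis by (simp only: coeff_norm_def sum_distrib_right)
qed

text \<open>The values at the nodes may be small only relative to the unknown size of the polynomial;
  interpolation turns this into an absolute bound, and being monic then forces full degree.\<close>

lemma monic_tendsto_root_poly:
  fixes H :: "nat \<Rightarrow> real poly" and E :: "nat \<Rightarrow> real"
  assumes X: "finite X" "X \<noteq> {}"
    and H: "\<forall>\<^sub>F n in sequentially. degree (H n) \<le> card X \<and> lead_coeff (H n) = 1 \<and>
              (\<forall>x\<in>X. \<bar>poly (H n) x\<bar> \<le> E n * (1 + coeff_norm (card X) (H n)))"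
    and E: "E \<longlonglongrightarrow> 0"
  shows "\<forall>\<^sub>F n in sequentially. degree (H n) = card X"
    and "(\<lambda>n. poly (H n) t) \<longlonglongrightarrow> poly (root_poly (mset_set X)) t"
proof -
  define N where "N = card X"
  define R where "R = root_poly (mset_set X)"
  have N: "N > 0" using X by (simp add: N_def card_gt_0_iff)
  have R: "degree R = N" "coeff R N = 1" using lead_coeff_root_poly[of "mset_set X"] by (simp_all add: R_def N_def)
  obtain C where C: "C \<ge> 0" "\<And>p. degree p < N \<Longrightarrow> coeff_norm N p \<le> C * (\<Sum>x\<in>X. \<bar>poly p x\<bar>)"
    using coeff_norm_interpolation_bound[OF X(1), of N] unfolding N_def by blast
  \<comment> \<open>With M the coefficient norm of \<open>H n\<close>, the estimate 1 + M \<le> 1 +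
    \<open>coeff_norm N R\<close> + (1 + M) / 2 solves to 1 + M \<le> K.\<close>
  define K where "K = 2 + 2 * coeff_norm N R"
  have K: "K \<ge> 2" by (simp add: K_def)
  have lim: "(\<lambda>n. C * real N * E n) \<longlonglongrightarrow> 0" using tendsto_mult_right_zero[OF E] by simp
  then have "\<forall>\<^sub>F n in sequentially. C * real N * E n < 1 / (2 * K)"
    using K by (intro order_tendstoD(2)[OF lim]) auto
  with H have main: "\<forall>\<^sub>F n in sequentially. degree (H n) = N \<and> 
      coeff_norm N (H n - R) \<le> C * real N * E n * K \<and> degree (H n - R) \<le> N"
  proof eventually_elim
    case (elim n)
    then have dH: "degree (H n) \<le> N" and lH: "lead_coeff (H n) = 1"
      and vH: "\<And>x. x \<in> X \<Longrightarrow> \<bar>poly (H n) x\<bar> \<le> E n * (1 + coeff_norm N (H n))"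
      and small: "C * real N * E n < 1 / (2 * K)" by (auto simp: N_def)
    \<comment> \<open>Equal to 1 or 0 according to whether \<open>H n\<close> has full degree.
      Subtracting \<open>smult s R\<close> brings the degree below N in either case and leaves the
      values at the nodes unchanged.\<close>
    define s where "s = coeff (H n) N"
    define G where "G = H n - smult s R"
    have s: "s = (if degree (H n) = N then 1 else 0)"
      using dH lH by (auto simp: s_def coeff_eq_0)
    have "degree G \<le> N" unfolding G_def using dH R by (intro degree_diff_le) auto
    moreover have "coeff G N = 0" by (simp add: G_def R s_def)
    ultimately have dG: "degree G < N" using N
      by (metis degree_0 le_neq_implies_less leading_coeff_0_iff)
    have "coeff_norm N G \<le> C * (\<Sum>x\<in>X. \<bar>poly G x\<bar>)" by (rule C(2)[OF dG])
    also have "(\<Sum>x\<in>X. \<bar>poly G x\<bar>) \<le> (\<Sum>x\<in>X. E n * (1 + coeff_norm N (H n)))"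
    proof (rule sum_mono)
      fix x assume "x \<in> X"
      moreover from this have "poly R x = 0" using X by (simp add: R_def)
      ultimately show "\<bar>poly G x\<bar> \<le> E n * (1 + coeff_norm N (H n))" using vH by (simp add: G_def)
    qed
    finally have G1: "coeff_norm N G \<le> C * real N * E n * (1 + coeff_norm N (H n))"
      using C(1) by (simp add: N_def mult_left_mono mult.assoc)
    have "coeff_norm N (H n) \<le> coeff_norm N (smult s R) + coeff_norm N G"
      using coeff_norm_triangle[of N "smult s R" G] by (simp add: G_def)
    also have "coeff_norm N (smult s R) \<le> coeff_norm N R" by (simp add: s) (simp add: coeff_norm_def sum_nonneg)
    finally have H1: "coeff_norm N (H n) \<le> coeff_norm N R + coeff_norm N G" by simp
    have half: "C * real N * E n \<le> 1 / 2" 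
      using small K by (smt (verit) frac_le)
    have "coeff_norm N G \<le> 1 / 2 * (1 + coeff_norm N (H n))"
      using G1 half by (rule order_trans[OF _ mult_right_mono]) simp
    with H1 have H2: "1 + coeff_norm N (H n) \<le> K" by (simp add: K_def)
    have "1 \<le> coeff_norm N (H n)"
    proof -
      have "\<bar>coeff (H n) (degree (H n))\<bar> \<le> coeff_norm N (H n)"
        unfolding coeff_norm_def using dH by (intro member_le_sum) auto
      then show ?thesis using lH by simp
    qed
    \<comment> \<open>If the degree dropped, \<open>H n\<close> itself would be interpolated from
      tiny values and have coefficient norm below 1, which its leading coefficient forbids.\<close>
    have "s = 1"
    proof (rule ccontr)
      assume "s \<noteq> 1"
      then have "G = H n" using s by (auto simp: G_def split: if_splits)
      then have "coeff_norm N (H n) \<le> C * real N * E n * (1 + coeff_norm N (H n))" using G1 by simp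
      also have "\<dots> \<le> 1 / (2 * K) * (1 + coeff_norm N (H n))"
        using small by (intro mult_right_mono) auto
      also have "\<dots> \<le> 1 / (2 * K) * K" using H2 K by (intro mult_left_mono) auto
      also have "\<dots> < 1" using K by simp
      finally show False using \<open>1 \<le> coeff_norm N (H n)\<close> by simp
    qed
    then have "G = H n - R" "degree (H n) = N" using s by (auto simp: G_def split: if_splits)
    moreover have "coeff_norm N G \<le> C * real N * E n * K"
    \<comment> \<open>The sign of \<open>E n\<close> is not prescribed; a negative product would
      make the bound \<open>G1\<close> negative, which is absurd for a norm.\<close>
    proof (cases "C * real N * E n \<ge> 0")
      case True
      show ?thesis using G1 H2 mult_left_mono[OF H2 True] by linarith
    next
      case False
      then have "C * real N * E n * (1 + coeff_norm N (H n)) < 0"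
        by (intro mult_neg_pos[of "C * real N * E n"]) (auto simp: not_le intro: add_pos_nonneg)
      then show ?thesis using G1 coeff_norm_nonneg[of N G] by linarith
    qed
    ultimately show ?case using dG by auto
  qed
  then show "\<forall>\<^sub>F n in sequentially. degree (H n) = card X" by (auto simp: N_def elim: eventually_mono)
  have "(\<lambda>n. poly (H n - R) t) \<longlonglongrightarrow> 0"
  proof (rule Lim_null_comparison)
    show "\<forall>\<^sub>F n in sequentially. norm (poly (H n - R) t) \<le> C * real N * E n * K * (\<Sum>j\<le>N. \<bar>t\<bar> ^ j)"
      using main
    proof eventually_elim
      case (elim n)
      have "\<bar>poly (H n - R) t\<bar> \<le> coeff_norm N (H n - R) * (\<Sum>j\<le>N. \<bar>t\<bar> ^ j)"
        using elim by (intro abs_poly_le_coeff_norm) auto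
      also have "\<dots> \<le> C * real N * E n * K * (\<Sum>j\<le>N. \<bar>t\<bar> ^ j)"
        using elim by (intro mult_right_mono) (auto intro: sum_nonneg)
      finally show ?case by simp
    qed
    show "(\<lambda>n. C * real N * E n * K * (\<Sum>j\<le>N. \<bar>t\<bar> ^ j)) \<longlonglongrightarrow> 0"
      using tendsto_mult_left_zero[OF tendsto_mult_left_zero[OF lim]] .
  qed
  then show "(\<lambda>n. poly (H n) t) \<longlonglongrightarrow> poly (root_poly (mset_set X)) t"
    by (simp add: R_def LIM_zero_iff)
qed

lemma root_near_node:
  fixes H :: "nat \<Rightarrow> real poly"
  assumes X: "finite X" "x \<in> X"
    and H: "\<And>t. (\<lambda>n. poly (H n) t) \<longlonglongrightarrow> poly (root_poly (mset_set X)) t"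
    and r: "r > 0" "\<And>y. y \<in> X \<Longrightarrow> y \<noteq> x \<Longrightarrow> r < \<bar>x - y\<bar>"
  shows "\<forall>\<^sub>F n in sequentially. \<exists>z. \<bar>z - x\<bar> < r \<and> poly (H n) z = 0"
proof -
  define R where "R = root_poly (mset_set X)"
  have R: "poly R t = (\<Prod>y\<in>X. t - y)" for t by (simp add: R_def poly_root_poly prod_unfold_prod_mset)
  \<comment> \<open>Paired up, the node y contributes (x - y)^2 - r^2, which is negative for y = x
    only. Hence \<open>R\<close> changes sign across x.\<close>
  have "poly R (x - r) * poly R (x + r) = (\<Prod>y\<in>X. (x - y)\<^sup>2 - r\<^sup>2)"
    unfolding R prod.distrib[symmetric] by (intro prod.cong) (auto simp: power2_eq_square algebra_simps)
  also have "\<dots> = (- (r\<^sup>2)) * (\<Prod>y\<in>X - {x}. (x - y)\<^sup>2 - r\<^sup>2)"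
    using X by (subst prod.remove[of X x]) auto
  also have "\<dots> < 0"
  proof (rule mult_neg_pos)
    show "(\<Prod>y\<in>X - {x}. (x - y)\<^sup>2 - r\<^sup>2) > 0"
    proof (rule prod_pos)
      fix y assume "y \<in> X - {x}"
      then have "r < \<bar>x - y\<bar>" using r(2) by auto
      then have "r\<^sup>2 < \<bar>x - y\<bar>\<^sup>2" using r(1) by (intro power_strict_mono) auto
      then show "(x - y)\<^sup>2 - r\<^sup>2 > 0" by simp
    qed
  qed (use r in simp)
  finally have neg: "poly R (x - r) * poly R (x + r) < 0" .
  have "(\<lambda>n. poly (H n) (x - r) * poly (H n) (x + r)) \<longlonglongrightarrow> poly R (x - r) * poly R (x + r)"
    unfolding R_def by (intro tendsto_mult H)
  then have "\<forall>\<^sub>F n in sequentially. poly (H n) (x - r) * poly (H n) (x + r) < 0"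
    using neg by (rule order_tendstoD)
  then show ?thesis
  proof eventually_elim
    case (elim n)
    then obtain z where "x - r < z" "z < x + r" "poly (H n) z = 0"
      using poly_IVT[of "x - r" "x + r" "H n"] r(1) by auto
    then show ?case by (intro exI[of _ z]) auto
  qed
qed

text \<open>Expresses the size of a polynomial at -b as a sum over its zeros. The normalisation by b
  makes each logarithm nonnegative, as the comparison of sums over zeros requires.\<close>

lemma exp_sum_ln_root_poly:
  assumes "\<forall>z\<in>#A. z > 0" "b > 0"
  shows "exp (\<Sum>z\<in>#A. ln ((z + b) / b)) = \<bar>poly (root_poly A) (- b)\<bar> / b ^ size A"
  using assms(1)
proof (induction A)
  case (add z A)
  have "(z + b) / b > 0" using add.prems assms(2) by (auto intro: divide_pos_pos add_pos_pos)
  moreover have "\<bar>poly (root_poly (add_mset z A)) (- b)\<bar> = (z + b) * \<bar>poly (root_poly A) (- b)\<bar>"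
  proof -
    have "poly (root_poly (add_mset z A)) (- b) = - (z + b) * poly (root_poly A) (- b)"
      by (simp add: algebra_simps)
    then show ?thesis using add.prems assms(2) by (simp add: abs_mult)
  qed
  ultimately show ?case using add by (simp add: exp_add)
qed simp

lemma log_deriv_root_poly:
  assumes "\<forall>z\<in>#A. z > 0" "b > 0"
  shows "\<bar>poly (pderiv (root_poly A)) (- b)\<bar> = \<bar>poly (root_poly A) (- b)\<bar> * (\<Sum>z\<in>#A. 1 / (z + b))"
proof -
  have "poly (pderiv (root_poly A)) (- b) = - (poly (root_poly A) (- b) * (\<Sum>z\<in>#A. 1 / (z + b)))"
    using assms(1)
  proof (induction A)
    case (add z A)
    have "poly (pderiv (root_poly (add_mset z A))) (- b)
        = - (z + b) * poly (pderiv (root_poly A)) (- b) + poly (root_poly A) (- b)"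
      unfolding root_poly_add_mset pderiv_mult by (simp add: pderiv_pCons algebra_simps)
    moreover have "poly (root_poly (add_mset z A)) (- b) = - (z + b) * poly (root_poly A) (- b)"
      by (simp add: algebra_simps)
    moreover have "z + b \<noteq> 0" using add.prems assms(2) by (auto simp: add_eq_0_iff)
    moreover have "poly (pderiv (root_poly A)) (- b) = - (poly (root_poly A) (- b) * (\<Sum>z\<in>#A. 1 / (z + b)))"
      using add by simp
    ultimately show ?case
      by (simp only: image_mset_add_mset sum_mset.add_mset) (simp add: field_simps)
  qed simp
  moreover have "(\<Sum>z\<in>#A. 1 / (z + b)) \<ge> 0"
    using assms by (intro sum_mset_nonneg) auto
  ultimately show ?thesis by (simp add: abs_mult)
qed

section \<open>Asymptotics for the Laguerre weight\<close>

locale laguerre_sobolev = laguerre_functional I a + discrete_sobolev I N w c d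
  for I a N w c d
begin

definition S :: "nat \<Rightarrow> real poly" where
  "S n = (THE p. is_orth n p)"

lemma is_orth_S: "is_orth n (S n)"
  unfolding S_def using is_orth_exists is_orth_unique by (metis theI)

lemma S_nonzero [simp]: "S n \<noteq> 0"
  using is_orth_S[of n] by (auto simp: is_orth_def)

lemma degree_S [simp]: "degree (S n) = n" and lead_coeff_S: "lead_coeff (S n) = 1"
  using is_orth_S[of n] by (auto simp: is_orth_def)

definition Z :: "nat \<Rightarrow> real multiset" where
  "Z n = roots_in {0<..} (S n)"

definition P :: "nat \<Rightarrow> real poly" where
  "P n = root_poly (Z n)"

definition H :: "nat \<Rightarrow> real poly" where
  "H n = S n div P n"

lemma Z_pos: "\<forall>z\<in>#Z n. z > 0"
  by (auto simp: Z_def set_roots_in)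

lemma S_factor: "S n = P n * H n"
proof -
  have "P n dvd S n" unfolding P_def Z_def by (rule root_poly_dvd) (auto simp: roots_in_def)
  then show ?thesis by (simp add: H_def)
qed

lemma H_nonzero: "H n \<noteq> 0"
  using S_factor[of n] S_nonzero[of n] by (metis mult_zero_right)

lemma degree_H: "size (Z n) + degree (H n) = n"
  using degree_S[of n] H_nonzero[of n] unfolding S_factor[of n] by (simp add: P_def degree_mult_eq)

lemma lead_coeff_H: "lead_coeff (H n) = 1"
  using lead_coeff_S[of n] unfolding S_factor[of n] by (simp only: lead_coeff_mult P_def lead_coeff_root_poly mult_1_left)

lemma card_odd_roots_le_size_Z: "card (odd_roots_in {0<..} (S n)) \<le> size (Z n)"
  unfolding Z_def using odd_roots_in_subset[of "{0<..}" "S n"]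
  by (intro card_le_size_roots_in) auto

lemma size_Z_ge:
  assumes "n \<ge> 2 * D"
  shows "n \<le> size (Z n) + N"
  using is_orth_many_odd_roots[OF is_orth_S assms] card_odd_roots_le_size_Z[of n] by linarith

lemma degree_H_le: "n \<ge> 2 * D \<Longrightarrow> degree (H n) \<le> N"
  using size_Z_ge[of n] degree_H[of n] by linarith

text \<open>The comparison of sums for g(x) = ln ((x + b) / b) and g(x) = 1 / (x + b). Both are
  monotone, so their superlevel sets are intervals. At the zeros of L_n the first is bounded through
  the bound for the largest zero, the second by 1 / b.\<close>

lemma laguerre_roots_comparison:
  assumes b: "b > 0"
  shows "\<bar>poly (laguerre a n) (- b)\<bar> / b ^ n
            \<le> \<bar>poly (P n) (- b)\<bar> / b ^ size (Z n) * ((real n * (a + real n) + b) / b) ^ D"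
    and "\<bar>poly (pderiv (laguerre a n)) (- b)\<bar>
            \<le> \<bar>poly (laguerre a n) (- b)\<bar> * ((\<Sum>z\<in>#Z n. 1 / (z + b)) + real D / b)"
proof -
  obtain Y where Y: "finite Y" "Y \<subseteq> {0<..}" "card Y = n" "laguerre a n = root_poly (mset_set Y)"
    "\<And>y. y \<in> Y \<Longrightarrow> y \<le> real n * (a + real n)" using laguerre_roots[of n] by blast
  have Ypos: "\<forall>y\<in>#mset_set Y. y > 0" using Y by auto
  have le: "(\<Sum>y\<in>Y. g y) \<le> (\<Sum>z\<in>#Z n. g z) + real D * F"
    if g: "\<And>s. is_interval {x. 0 < x \<and> s \<le> g x}" "\<And>x. x > 0 \<Longrightarrow> g x \<ge> 0"
          "\<And>y. y \<in> Y \<Longrightarrow> g y \<le> F" "F \<ge> 0" for g F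
    unfolding Z_def degree_\<rho>[symmetric]
    by (rule orthogonal_root_sum_le[OF Y(1,3,2,4) laguerre_orth S_nonzero _ poly_\<rho>_pos is_orth_quasi[OF is_orth_S] g]) auto
  define M where "M = real n * (a + real n)"
  have M: "M \<ge> 0" using a_pos by (simp add: M_def)
  have pos: "(x + b) / b \<ge> 1" if "x \<ge> 0" for x using that b by simp
  have "(\<Sum>y\<in>Y. ln ((y + b) / b)) \<le> (\<Sum>z\<in>#Z n. ln ((z + b) / b)) + real D * ln ((M + b) / b)"
  proof (rule le)
    show "is_interval {x. 0 < x \<and> s \<le> ln ((x + b) / b)}" for s
      unfolding is_interval_1
    proof (intro ballI allI impI, unfold mem_Collect_eq)
      fix x y z assume xy: "0 < x \<and> s \<le> ln ((x + b) / b)" "x \<le> z \<and> z \<le> y"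
      then have "ln ((x + b) / b) \<le> ln ((z + b) / b)"
        using b by (subst ln_le_cancel_iff) (auto intro!: divide_right_mono divide_pos_pos add_pos_pos)
      then show "0 < z \<and> s \<le> ln ((z + b) / b)" using xy by auto
    qed
    show "ln ((x + b) / b) \<ge> 0" if "x > 0" for x using pos[of x] that by (intro ln_ge_zero) auto
    show "ln ((y + b) / b) \<le> ln ((M + b) / b)" if "y \<in> Y" for y
      using Y that b M by (subst ln_le_cancel_iff) (auto simp: M_def intro!: divide_right_mono divide_pos_pos add_pos_pos add_nonneg_pos)
    show "ln ((M + b) / b) \<ge> 0" using pos[OF M] by (intro ln_ge_zero) auto
  qed
  then have "exp (\<Sum>y\<in>#mset_set Y. ln ((y + b) / b)) \<le> exp ((\<Sum>z\<in>#Z n. ln ((z + b) / b)) + real D * ln ((M + b) / b))"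
    by (simp add: sum_unfold_sum_mset)
  also have "\<dots> = exp (\<Sum>z\<in>#Z n. ln ((z + b) / b)) * ((M + b) / b) ^ D"
    using pos[OF M] by (simp add: exp_add exp_of_nat_mult)
  finally show "\<bar>poly (laguerre a n) (- b)\<bar> / b ^ n
            \<le> \<bar>poly (P n) (- b)\<bar> / b ^ size (Z n) * ((real n * (a + real n) + b) / b) ^ D"
    unfolding exp_sum_ln_root_poly[OF Ypos b] exp_sum_ln_root_poly[OF Z_pos b] Y(4)[symmetric] P_def M_def
    using Y(3) by simp
  have "(\<Sum>y\<in>Y. 1 / (y + b)) \<le> (\<Sum>z\<in>#Z n. 1 / (z + b)) + real D * (1 / b)"
  proof (rule le)
    show "is_interval {x. 0 < x \<and> s \<le> 1 / (x + b)}" for s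
      unfolding is_interval_1
    proof (intro ballI allI impI, unfold mem_Collect_eq)
      fix x y z assume xy: "0 < x \<and> s \<le> 1 / (x + b)" "0 < y \<and> s \<le> 1 / (y + b)" "x \<le> z \<and> z \<le> y"
      then have "1 / (y + b) \<le> 1 / (z + b)" using b by (intro divide_left_mono) (auto intro!: mult_pos_pos)
      then show "0 < z \<and> s \<le> 1 / (z + b)" using xy by auto
    qed
    show "1 / (x + b) \<ge> 0" if "x > 0" for x using that b by simp
    show "1 / (y + b) \<le> 1 / b" if "y \<in> Y" for y
      using Y that b by (intro divide_left_mono) (auto intro!: mult_pos_pos add_pos_pos)
    show "1 / b \<ge> 0" using b by simp
  qed
  then have "\<bar>poly (laguerre a n) (- b)\<bar> * (\<Sum>y\<in>#mset_set Y. 1 / (y + b))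
      \<le> \<bar>poly (laguerre a n) (- b)\<bar> * ((\<Sum>z\<in>#Z n. 1 / (z + b)) + real D / b)"
    by (intro mult_left_mono) (simp_all add: sum_unfold_sum_mset)
  then show "\<bar>poly (pderiv (laguerre a n)) (- b)\<bar>
            \<le> \<bar>poly (laguerre a n) (- b)\<bar> * ((\<Sum>z\<in>#Z n. 1 / (z + b)) + real D / b)"
    unfolding Y(4) log_deriv_root_poly[OF Ypos b] .
qed

text \<open>At -b the logarithmic derivative of L_n eventually exceeds M / (2 b) in modulus for
  every M, and the passage to the zeros in \<open>Z n\<close> loses at most D / b.\<close>

lemma sum_inverse_Z_at_top:
  assumes b: "b > 0"
  shows "filterlim (\<lambda>n. \<Sum>z\<in>#Z n. 1 / (z + b)) at_top sequentially"
  unfolding filterlim_at_top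
proof
  fix R :: real
  obtain M :: nat where M: "real M \<ge> 2 * b * (R + real D / b)" using real_arch_simple by blast
  obtain n0 :: nat where n0: "real n0 \<ge> real M + 2 * real M * (a + real M) / b" using real_arch_simple by blast
  show "\<forall>\<^sub>F n in sequentially. R \<le> (\<Sum>z\<in>#Z n. 1 / (z + b))"
    using eventually_ge_at_top[of n0]
  proof eventually_elim
    case (elim n)
    let ?L = "\<bar>poly (laguerre a n) (- b)\<bar>" and ?s = "\<Sum>z\<in>#Z n. 1 / (z + b)"
    have "real n \<ge> real M + 2 * real M * (a + real M) / b" using n0 elim by linarith
    then have "real M * ?L \<le> 2 * b * \<bar>poly (pderiv (laguerre a n)) (- b)\<bar>"
      using laguerre_log_deriv_lower_bound a_pos b by blast
    also have "\<dots> \<le> 2 * b * (?L * (?s + real D / b))"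
      using b laguerre_roots_comparison(2)[OF b, of n] by (intro mult_left_mono) auto
    finally have "?L * real M \<le> ?L * (2 * b * (?s + real D / b))" by (simp only: mult_ac)
    moreover have "?L > 0"
    proof -
      have "real (n choose 0) * (pochhammer a n / pochhammer a 0) * b ^ 0 \<le> ?L"
        using abs_poly_laguerre_lower_bound[of a b 0 n] a_pos b by simp
      then show ?thesis using pochhammer_pos[OF a_pos, of n] by simp
    qed
    ultimately have "real M \<le> 2 * b * (?s + real D / b)" by simp
    then have "2 * b * (R + real D / b) \<le> 2 * b * (?s + real D / b)" using M by linarith
    then show ?case using b by simp
  qed
qed

text \<open>The squared norm of \<open>laguerre a n\<close>, see
  \<open>laguerre_norm\<close>.\<close>

definition h :: "nat \<Rightarrow> real" where
  "h n = Gamma a * pochhammer a n * fact n"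

lemma h_pos: "h n > 0"
  using a_pos by (auto simp: h_def intro!: mult_pos_pos pochhammer_pos)

text \<open>The quotient of consecutive values is (a + k) (k + 1). It is at least 1 from k = 1 on,
  whereas at k = 0 it equals a, which may be smaller.\<close>

lemma h_mono:
  assumes "1 \<le> i" "i \<le> j"
  shows "h i \<le> h j"
  using assms(2)
proof (induction rule: dec_induct)
  case (step k)
  have "h (Suc k) = h k * ((a + real k) * real (Suc k))"
    by (simp add: h_def pochhammer_rec' algebra_simps)
  moreover have "1 * 1 \<le> (a + real k) * real (Suc k)"
    using step assms(1) a_pos by (intro mult_mono) auto
  ultimately have "h k \<le> h (Suc k)" using h_pos[of k] by (simp add: mult_le_cancel_left1)
  then show ?case using step by simp
qed simp

text \<open>The monic test polynomial \<open>\<rho> * laguerre a (n - D)\<close> has no discrete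
  part. Since \<open>\<rho>\<close> is unbounded on the half-line, the integral is replaced by
  quadrature: at the nodes, \<open>\<rho>\<close> is at most a power of n.\<close>

lemma norm_S_bound:
  assumes \<gamma>: "\<And>j. j \<in> {1..N} \<Longrightarrow> - c j \<le> \<gamma>" "\<gamma> \<ge> 0" and n: "n > D"
  shows "B (S n) (S n) \<le> (real (Suc n) * (a + real (Suc n)) + \<gamma>) ^ (2 * D) * h n"
proof -
  define K where "K = real (Suc n) * (a + real (Suc n)) + \<gamma>"
  define f where "f = \<rho> * laguerre a (n - D)"
  have degf: "degree f = n" using n
    by (simp add: f_def degree_mult_eq degree_\<rho> \<rho>_nonzero) 
       (metis add_diff_inverse_nat coeff_0 degree_\<rho> degree_laguerre degree_mult_eq lead_coeff_laguerre less_imp_not_less \<rho>_nonzero zero_neq_one)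
  have leadf: "lead_coeff f = 1"
    unfolding f_def lead_coeff_mult lead_coeff_\<rho> by simp
  \<comment> \<open>With n + 1 nodes the rule is exact up to degree 2n + 1, hence for the square of
    \<open>f\<close>, which has degree 2n.\<close>
  obtain Y where Y: "finite Y" "Y \<subseteq> {0<..}" "card Y = Suc n" "laguerre a (Suc n) = root_poly (mset_set Y)"
    "\<And>y. y \<in> Y \<Longrightarrow> y \<le> real (Suc n) * (a + real (Suc n))" using laguerre_roots[of "Suc n"] by blast
  obtain v where v: "\<And>y. y \<in> Y \<Longrightarrow> v y > 0"
    "\<And>g. degree g < 2 * Suc n \<Longrightarrow> I g = (\<Sum>y\<in>Y. v y * poly g y)"
    using Gauss_quadrature[OF Y(1,3,4) laguerre_orth] by blast
  let ?L = "laguerre a (n - D)"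
  have rho: "(poly \<rho> y)\<^sup>2 \<le> K ^ (2 * D)" if "y \<in> Y" for y
  proof -
    have y: "0 < y" "y \<le> real (Suc n) * (a + real (Suc n))" using Y that by auto
    have "poly \<rho> y = (\<Prod>j=1..N. (y - c j) ^ Suc (d j))" by (simp add: \<rho>_def poly_prod del: power_Suc)
    also have "\<dots> \<le> (\<Prod>j=1..N. K ^ Suc (d j))"
    proof (intro prod_mono conjI)
      fix j assume "j \<in> {1..N}"
      then have "0 \<le> y - c j" "y - c j \<le> K" using y c_neg[of j] \<gamma>(1)[of j] by (auto simp: K_def)
      then show "0 \<le> (y - c j) ^ Suc (d j)" "(y - c j) ^ Suc (d j) \<le> K ^ Suc (d j)"
        by (auto intro: zero_le_power power_mono simp del: power_Suc)
    qed
    also have "\<dots> = K ^ D" by (simp add: D_def power_sum del: power_Suc)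
    finally have "(poly \<rho> y)\<^sup>2 \<le> (K ^ D)\<^sup>2" using poly_\<rho>_pos[OF y(1)] by (intro power_mono) auto
    then show ?thesis by (simp add: power_mult[symmetric] mult.commute)
  qed
  have "B (S n) (S n) \<le> B f f" by (rule is_orth_minimal[OF is_orth_S degf]) (use leadf in simp)
  also have "B f f = I (f * f)" using B_\<rho>_mult[of ?L f] by (simp add: f_def)
  also have "I (f * f) = (\<Sum>y\<in>Y. v y * poly (f * f) y)"
    by (rule v) (use degree_mult_le[of f f] degf in simp)
  also have "\<dots> \<le> (\<Sum>y\<in>Y. K ^ (2 * D) * (v y * poly (?L * ?L) y))"
  proof (rule sum_mono)
    fix y assume y: "y \<in> Y"
    have "v y * poly (f * f) y = (poly \<rho> y)\<^sup>2 * (v y * (poly ?L y)\<^sup>2)"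
      by (simp add: f_def power2_eq_square)
    also have "\<dots> \<le> K ^ (2 * D) * (v y * (poly ?L y)\<^sup>2)"
      using rho[OF y] v(1)[OF y] by (intro mult_right_mono) auto
    finally show "v y * poly (f * f) y \<le> K ^ (2 * D) * (v y * poly (?L * ?L) y)"
      by (simp add: power2_eq_square)
  qed
  also have "\<dots> = K ^ (2 * D) * I (?L * ?L)"
    unfolding sum_distrib_left[symmetric]
    by (subst v(2)) (use degree_mult_le[of ?L ?L] in auto)
  also have "\<dots> = K ^ (2 * D) * h (n - D)" by (simp add: laguerre_norm h_def)
  also have "\<dots> \<le> K ^ (2 * D) * h n"
  proof (intro mult_left_mono h_mono)
    show "0 \<le> K ^ (2 * D)" by simp
  qed (use n in auto)
  finally show ?thesis by (simp add: K_def)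
qed

text \<open>The k-th term of the expansion gives |L_n(-b)| at least a constant times n^k
  \<open>pochhammer a n\<close>. Squaring gives the exponent 2k, and one power is spent on comparing
  the factorial in \<open>h n\<close> with \<open>pochhammer a n\<close>.\<close>

lemma laguerre_superpolynomial:
  assumes b: "b > 0" and k: "k \<ge> 1"
  shows "\<exists>C>0. \<forall>n\<ge>k. C * real n ^ (2 * k - 1) * h n \<le> (poly (laguerre a n) (- b))\<^sup>2"
proof (intro exI conjI allI impI)
  define q where "q = b ^ k / (real k ^ k * pochhammer a k)"
  have q: "q > 0" using b k a_pos by (auto simp: q_def intro!: divide_pos_pos mult_pos_pos pochhammer_pos)
  let ?C = "q\<^sup>2 * (a / Gamma a)"
  show "?C > 0" using q a_pos by auto
  fix n assume n: "n \<ge> k"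
  then have n1: "n \<ge> 1" using k by simp
  have pn: "pochhammer a n > 0" using a_pos by (rule pochhammer_pos)
  have "q * real n ^ k * pochhammer a n = (real n / real k) ^ k * (pochhammer a n / pochhammer a k) * b ^ k"
    by (simp add: q_def power_divide)
  also have "\<dots> \<le> real (n choose k) * (pochhammer a n / pochhammer a k) * b ^ k"
    using binomial_ge_n_over_k_pow_k[OF n, where 'a = real] pn pochhammer_pos[OF a_pos, of k] b
    by (intro mult_right_mono) auto
  also have "\<dots> \<le> \<bar>poly (laguerre a n) (- b)\<bar>"
    by (rule abs_poly_laguerre_lower_bound[OF a_pos b n])
  finally have "(q * real n ^ k * pochhammer a n)\<^sup>2 \<le> \<bar>poly (laguerre a n) (- b)\<bar>\<^sup>2"
    using q pn by (intro power_mono) auto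
  moreover have "?C * real n ^ (2 * k - 1) * h n \<le> (q * real n ^ k * pochhammer a n)\<^sup>2"
  proof -
    have "a * fact n \<le> real n * pochhammer a n"
    proof -
      obtain m where m: "n = Suc m" using n1 by (cases n) auto
      have "pochhammer 1 m \<le> pochhammer (a + 1) m"
        unfolding pochhammer_prod using a_pos by (intro prod_mono) auto
      then have "fact m \<le> pochhammer (a + 1) m" by (simp add: pochhammer_fact)
      then have "a * real n * fact m \<le> a * real n * pochhammer (a + 1) m"
        using a_pos by (intro mult_left_mono) auto
      then show ?thesis unfolding m pochhammer_rec by (simp add: mult_ac)
    qed
    then have "(q\<^sup>2 * real n ^ (2 * k - 1) * pochhammer a n) * (a * fact n)
        \<le> (q\<^sup>2 * real n ^ (2 * k - 1) * pochhammer a n) * (real n * pochhammer a n)"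
      using pn by (intro mult_left_mono) auto
    moreover have "?C * real n ^ (2 * k - 1) * h n = (q\<^sup>2 * real n ^ (2 * k - 1) * pochhammer a n) * (a * fact n)"
      using Gamma_real_pos[OF a_pos] by (simp add: h_def)
    moreover have "(q * real n ^ k * pochhammer a n)\<^sup>2 = (q\<^sup>2 * real n ^ (2 * k - 1) * pochhammer a n) * (real n * pochhammer a n)"
    proof -
      have "(real n ^ k)\<^sup>2 = real n ^ (2 * k - 1) * real n"
        using k by (simp add: power_mult[symmetric] mult.commute power_Suc[symmetric] del: power_Suc)
      then show ?thesis by (simp add: power_mult_distrib power2_eq_square[of "pochhammer a n"] mult_ac)
    qed
    ultimately show ?thesis by simp
  qed
  ultimately show "?C * real n ^ (2 * k - 1) * h n \<le> (poly (laguerre a n) (- b))\<^sup>2" by simp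
qed

end

section \<open>Decay of S against P at the mass points, and the limit of H\<close>

context laguerre_sobolev
begin

lemma norm_S_negligible:
  assumes b: "b > 0"
  shows "\<exists>C>0. \<exists>n0. \<forall>n\<ge>n0. B (S n) (S n) * real n \<le> C * (poly (P n) (- b))\<^sup>2"
proof -
  define \<gamma> where "\<gamma> = (\<Sum>j=1..N. - c j)"
  have \<gamma>: "- c j \<le> \<gamma>" if "j \<in> {1..N}" for j
    unfolding \<gamma>_def using that c_neg by (intro member_le_sum) (auto intro: less_imp_le)
  have \<gamma>0: "\<gamma> \<ge> 0" unfolding \<gamma>_def using c_neg by (intro sum_nonneg) (auto intro: less_imp_le)
  \<comment> \<open>Then 2 k - 1 = 8 D + 1: the norm of S_n costs n^(4 D), the squared comparison of
    L_n with P costs n^(4 D) again, and one power remains for the factor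
    \<open>real n\<close>.\<close>
  define k where "k = 4 * D + 1"
  obtain C0 where C0: "C0 > 0" "\<And>n. n \<ge> k \<Longrightarrow> C0 * real n ^ (2 * k - 1) * h n \<le> (poly (laguerre a n) (- b))\<^sup>2"
    using laguerre_superpolynomial[OF b, of k] by (auto simp: k_def)
  \<comment> \<open>Chosen so that \<open>T * (real n)\<^sup>2\<close> dominates both the base in
    \<open>norm_S_bound\<close> and the numerator \<open>real n * (a + real n) + b\<close> of the
    zero comparison.\<close>
  define T where "T = 2 * (a + 2) + \<gamma> + b"
  \<comment> \<open>P has deg H fewer zeros than L_n, so a factor b^(deg H) appears; as b may lie on
    either side of 1, it is bounded by \<open>\<beta> ^ N\<close>.\<close>
  define \<beta> where "\<beta> = max 1 b"
  have T: "T > 0" using a_pos b \<gamma>0 by (simp add: T_def)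
  have \<beta>: "\<beta> \<ge> 1" "b \<le> \<beta>" by (auto simp: \<beta>_def)
  define C where "C = T ^ (2 * D) * \<beta> ^ (2 * N) * (T / b) ^ (2 * D) / C0"
  have "C > 0" using T \<beta> b C0(1) unfolding C_def by (intro divide_pos_pos mult_pos_pos zero_less_power) auto
  moreover have "B (S n) (S n) * real n \<le> C * (poly (P n) (- b))\<^sup>2" if n: "n \<ge> k" for n
  proof -
    have n1: "n \<ge> 1" "real n \<ge> 1" and nD: "n > D" "n \<ge> 2 * D" using n by (auto simp: k_def)
    let ?L = "poly (laguerre a n) (- b)" and ?P = "poly (P n) (- b)"
    have sq: "x \<le> x * (real n)\<^sup>2" if "x \<ge> 0" for x
      using that n1 by (simp add: mult_le_cancel_left1 one_le_power)
    have K1: "real (Suc n) * (a + real (Suc n)) \<le> 2 * (a + 2) * (real n)\<^sup>2"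
    proof -
      have "a \<le> a * real n" using a_pos n1 by (simp add: mult_le_cancel_left1)
      then have "a + real (Suc n) \<le> (a + 2) * real n"
        using n1(2) unfolding distrib_right of_nat_Suc by linarith
      then have "real (Suc n) * (a + real (Suc n)) \<le> (2 * real n) * ((a + 2) * real n)"
        using n1 a_pos by (intro mult_mono) auto
      then show ?thesis by (simp add: power2_eq_square mult_ac)
    qed
    have K: "real (Suc n) * (a + real (Suc n)) + \<gamma> \<le> T * (real n)\<^sup>2"
      using K1 sq[of \<gamma>] sq[of b] \<gamma>0 b unfolding T_def distrib_right by linarith
    have "real n * (a + real n) \<le> real (Suc n) * (a + real (Suc n))"
      using a_pos by (intro mult_mono) auto
    then have M: "real n * (a + real n) + b \<le> T * (real n)\<^sup>2"
      using K1 sq[of \<gamma>] sq[of b] \<gamma>0 b unfolding T_def distrib_right by linarith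
    have "B (S n) (S n) \<le> (real (Suc n) * (a + real (Suc n)) + \<gamma>) ^ (2 * D) * h n"
      by (rule norm_S_bound[OF \<gamma> \<gamma>0 nD(1)])
    also have "\<dots> \<le> (T * (real n)\<^sup>2) ^ (2 * D) * h n"
      using K h_pos[of n] a_pos \<gamma>0 by (intro mult_right_mono power_mono) auto
    finally have s: "B (S n) (S n) \<le> T ^ (2 * D) * real n ^ (4 * D) * h n"
      by (simp add: power_mult_distrib power_mult[symmetric])
    have "\<bar>?L\<bar> / b ^ n \<le> \<bar>?P\<bar> / b ^ size (Z n) * ((real n * (a + real n) + b) / b) ^ D"
      by (rule laguerre_roots_comparison(1)[OF b])
    also have "\<dots> \<le> \<bar>?P\<bar> / b ^ size (Z n) * (T / b * (real n)\<^sup>2) ^ D"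
    proof -
      have "(real n * (a + real n) + b) / b \<le> T / b * (real n)\<^sup>2" using divide_right_mono[OF M, of b] b by simp
      then show ?thesis using b a_pos by (intro mult_left_mono power_mono) auto
    qed
    finally have "\<bar>?L\<bar> \<le> \<bar>?P\<bar> / b ^ size (Z n) * (T / b * (real n)\<^sup>2) ^ D * b ^ n"
      using b by (simp add: pos_divide_le_eq)
    also have "b ^ n = b ^ size (Z n) * b ^ degree (H n)" by (simp add: power_add[symmetric] degree_H)
    also have "\<bar>?P\<bar> / b ^ size (Z n) * (T / b * (real n)\<^sup>2) ^ D * (b ^ size (Z n) * b ^ degree (H n))
        = (\<bar>?P\<bar> * (T / b * (real n)\<^sup>2) ^ D) * b ^ degree (H n)"
      using b by simp
    also have "\<dots> \<le> (\<bar>?P\<bar> * (T / b * (real n)\<^sup>2) ^ D) * \<beta> ^ N"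
    proof (intro mult_left_mono)
      have "b ^ degree (H n) \<le> \<beta> ^ degree (H n)" using \<beta> b by (intro power_mono) auto
      also have "\<dots> \<le> \<beta> ^ N" using \<beta> degree_H_le[OF nD(2)] by (intro power_increasing) auto
      finally show "b ^ degree (H n) \<le> \<beta> ^ N" .
    qed (use T b in auto)
    finally have "\<bar>?L\<bar>\<^sup>2 \<le> ((\<bar>?P\<bar> * (T / b * (real n)\<^sup>2) ^ D) * \<beta> ^ N)\<^sup>2" by (intro power_mono) auto
    also have "\<dots> = ?P\<^sup>2 * (T / b) ^ (2 * D) * real n ^ (4 * D) * \<beta> ^ (2 * N)"
    proof -
      have "real n ^ (4 * D) = (((real n)\<^sup>2) ^ D)\<^sup>2" by (simp add: power_mult[symmetric] mult_ac)
      moreover have "(T / b) ^ (2 * D) = ((T / b) ^ D)\<^sup>2" "\<beta> ^ (2 * N) = (\<beta> ^ N)\<^sup>2"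
        by (simp_all add: power_mult[symmetric] mult.commute[of 2])
      ultimately show ?thesis by (simp only: power_mult_distrib power2_abs mult_ac)
    qed
    finally have L: "?L\<^sup>2 \<le> ?P\<^sup>2 * (T / b) ^ (2 * D) * real n ^ (4 * D) * \<beta> ^ (2 * N)" by simp
    have "C0 * (B (S n) (S n) * real n) * real n ^ (4 * D)
        \<le> C0 * (T ^ (2 * D) * real n ^ (4 * D) * h n * real n) * real n ^ (4 * D)"
      using C0(1) s by (intro mult_right_mono mult_left_mono) auto
    also have "\<dots> = T ^ (2 * D) * (C0 * real n ^ (2 * k - 1) * h n)"
    proof -
      have "2 * k - 1 = 4 * D + 4 * D + 1" by (simp add: k_def)
      then have "real n ^ (2 * k - 1) = real n ^ (4 * D) * real n ^ (4 * D) * real n"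
        by (simp only: power_add power_one_right)
      then show ?thesis by (simp only: mult_ac)
    qed
    also have "\<dots> \<le> T ^ (2 * D) * ?L\<^sup>2" using C0(2)[OF n] T by (intro mult_left_mono) auto
    also have "\<dots> \<le> T ^ (2 * D) * (?P\<^sup>2 * (T / b) ^ (2 * D) * real n ^ (4 * D) * \<beta> ^ (2 * N))"
      using L T by (intro mult_left_mono) auto
    also have "\<dots> = C0 * (C * ?P\<^sup>2) * real n ^ (4 * D)"
      using C0(1) by (simp add: C_def)
    finally have "C0 * (B (S n) (S n) * real n) \<le> C0 * (C * ?P\<^sup>2)"
      using n1 by (subst (asm) mult_le_cancel_right) auto
    then show ?thesis using C0(1) by simp
  qed
  ultimately show ?thesis by blast
qed

lemma poly_P_nonzero: "b > 0 \<Longrightarrow> poly (P n) (- b) \<noteq> 0"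
  unfolding P_def using Z_pos[of n] by (auto dest: bspec)

text \<open>\<open>norm_S_negligible\<close> compares with the value of P, whereas a Taylor
  coefficient of higher order is needed in the denominator; by this bound the replacement only
  helps.\<close>

lemma eventually_taylor_P_ge:
  assumes b: "b > 0"
  shows "\<forall>\<^sub>F n in sequentially. \<bar>poly (P n) (- b)\<bar> \<le> \<bar>taylor_coeff (- b) i (P n)\<bar>"
proof (induction i)
  case (Suc i)
  have "\<forall>\<^sub>F n in sequentially. real (Suc i) + real i / b \<le> (\<Sum>z\<in>#Z n. 1 / (z + b))"
    using sum_inverse_Z_at_top[OF b] by (simp add: filterlim_at_top)
  with Suc.IH show ?case
  proof eventually_elim
    case (elim n)
    let ?t = "\<lambda>i. \<bar>taylor_coeff (- b) i (P n)\<bar>"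
    have "real (Suc i) * ?t i \<le> ((\<Sum>z\<in>#Z n. 1 / (z + b)) - real i / b) * ?t i"
      using elim by (intro mult_right_mono) auto
    also have "\<dots> \<le> real (Suc i) * ?t (Suc i)"
      unfolding P_def by (rule taylor_coeff_root_poly_growth[OF Z_pos b])
    finally have "?t i \<le> ?t (Suc i)" by simp
    then show ?case using elim by linarith
  qed
qed simp

lemma eventually_taylor_P_nonzero:
  "b > 0 \<Longrightarrow> \<forall>\<^sub>F n in sequentially. taylor_coeff (- b) i (P n) \<noteq> 0"
  using eventually_taylor_P_ge[of b i] poly_P_nonzero by (auto elim: eventually_mono)

lemma taylor_P_ratio_tendsto_0:
  assumes b: "b > 0"
  shows "i < e \<Longrightarrow> (\<lambda>n. taylor_coeff (- b) i (P n) / taylor_coeff (- b) e (P n)) \<longlonglongrightarrow> 0"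
proof (induction e)
  case (Suc e)
  let ?A = "\<lambda>n. \<Sum>z\<in>#Z n. 1 / (z + b)"
  let ?t = "\<lambda>i n. taylor_coeff (- b) i (P n)"
  have step: "(\<lambda>n. ?t e n / ?t (Suc e) n) \<longlonglongrightarrow> 0"
  proof (rule Lim_null_comparison)
    have "\<forall>\<^sub>F n in sequentially. 1 + real e / b \<le> ?A n"
      using sum_inverse_Z_at_top[OF b] by (simp add: filterlim_at_top)
    with eventually_taylor_P_nonzero[OF b, of "Suc e"]
    show "\<forall>\<^sub>F n in sequentially. norm (?t e n / ?t (Suc e) n) \<le> real (Suc e) / (- (real e / b) + ?A n)"
    proof eventually_elim
      case (elim n)
      define A' where "A' = - (real e / b) + ?A n"
      have "A' > 0" using elim by (simp add: A'_def)
      moreover have "A' * \<bar>?t e n\<bar> \<le> real (Suc e) * \<bar>?t (Suc e) n\<bar>"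
        using taylor_coeff_root_poly_growth[OF Z_pos b, of n e] by (simp add: P_def A'_def)
      ultimately show ?case using elim(1) unfolding A'_def[symmetric]
        by (simp add: divide_le_eq pos_le_divide_eq mult.commute)
    qed
    show "(\<lambda>n. real (Suc e) / (- (real e / b) + ?A n)) \<longlonglongrightarrow> 0"
      by (intro tendsto_divide_0[OF tendsto_const] filterlim_at_top_imp_at_infinity
           filterlim_tendsto_add_at_top[OF tendsto_const] sum_inverse_Z_at_top b)
  qed
  show ?case
  proof (cases "i = e")
    case True
    then show ?thesis using step by simp
  next
    case False
    then have "(\<lambda>n. ?t i n / ?t e n) \<longlonglongrightarrow> 0" using Suc by simp
    from tendsto_mult[OF this step] have "(\<lambda>n. (?t i n / ?t e n) * (?t e n / ?t (Suc e) n)) \<longlonglongrightarrow> 0" by simp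
    moreover have "\<forall>\<^sub>F n in sequentially. (?t i n / ?t e n) * (?t e n / ?t (Suc e) n) = ?t i n / ?t (Suc e) n"
      using eventually_taylor_P_nonzero[OF b, of e] by eventually_elim simp
    ultimately show ?thesis by (rule Lim_transform_eventually)
  qed
qed simp

text \<open>As w_j > 0, the single discrete term w_j S_n^(d_j)(c_j)^2 is bounded by the squared norm
  of S_n. The spare factor n in \<open>norm_S_negligible\<close> yields the decay 1 / sqrt
  n.\<close>

lemma taylor_S_ratio_tendsto_0:
  assumes j: "j \<in> {1..N}"
  shows "(\<lambda>n. taylor_coeff (c j) (d j) (S n) / taylor_coeff (c j) (d j) (P n)) \<longlonglongrightarrow> 0"
proof -
  define b where "b = - c j"
  have b: "b > 0" "c j = - b" using c_neg[OF j] by (auto simp: b_def)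
  obtain C n0 where C: "C > 0" "\<And>n. n \<ge> n0 \<Longrightarrow> B (S n) (S n) * real n \<le> C * (poly (P n) (- b))\<^sup>2"
    using norm_S_negligible[OF b(1)] by blast
  have "(\<lambda>n. sqrt ((C / w j) / real n)) \<longlonglongrightarrow> sqrt 0" by (intro tendsto_real_sqrt lim_const_over_n)
  then have lim: "(\<lambda>n. sqrt ((C / w j) / real n)) \<longlonglongrightarrow> 0" by simp
  have "\<forall>\<^sub>F n in sequentially. norm (taylor_coeff (c j) (d j) (S n) / taylor_coeff (c j) (d j) (P n)) 
      \<le> sqrt ((C / w j) / real n)"
    using eventually_taylor_P_ge[OF b(1), of "d j"] eventually_ge_at_top[of n0] eventually_gt_at_top[of 0]
  proof eventually_elim
    case (elim n)
    let ?s = "taylor_coeff (c j) (d j) (S n)" and ?p = "taylor_coeff (c j) (d j) (P n)" and ?P = "poly (P n) (- b)"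
    let ?D = "poly ((pderiv ^^ d j) (S n)) (c j)"
    have "w j * ?D * ?D \<le> (\<Sum>j=1..N. w j * poly ((pderiv ^^ d j) (S n)) (c j) * poly ((pderiv ^^ d j) (S n)) (c j))"
      using j w_pos by (intro member_le_sum[of j]) (auto simp: mult.assoc intro!: mult_nonneg_nonneg[OF less_imp_le[OF w_pos] zero_le_square])
    moreover have "I (S n * S n) \<ge> 0" by (intro I_nonneg) simp
    ultimately have 1: "w j * ?D\<^sup>2 \<le> B (S n) (S n)" by (simp add: B_def power2_eq_square mult.assoc)
    have "1 * \<bar>?s\<bar> \<le> fact (d j) * \<bar>?s\<bar>" by (intro mult_right_mono) (auto simp: fact_ge_1)
    then have "\<bar>?s\<bar> \<le> \<bar>?D\<bar>" by (simp add: higher_pderiv_eq_taylor_coeff abs_mult)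
    then have "?s\<^sup>2 \<le> ?D\<^sup>2" by (rule abs_le_square_iff[THEN iffD1])
    then have "w j * ?s\<^sup>2 * real n \<le> w j * ?D\<^sup>2 * real n"
      using w_pos[OF j] by (intro mult_right_mono mult_left_mono) auto
    also have "\<dots> \<le> B (S n) (S n) * real n" using 1 by (intro mult_right_mono) auto
    also have "\<dots> \<le> C * ?P\<^sup>2" using C(2) elim by simp
    also have "\<dots> \<le> C * ?p\<^sup>2"
      using elim C(1) abs_le_square_iff[of ?P ?p] b(2) by (intro mult_left_mono) auto
    finally have "(?s / ?p)\<^sup>2 \<le> (C / w j) / real n"
      using w_pos[OF j] elim poly_P_nonzero[OF b(1), of n] b(2)
      by (auto simp: power_divide field_simps)
    then have "\<bar>?s / ?p\<bar> \<le> sqrt ((C / w j) / real n)" by (metis real_le_rsqrt abs_le_iff real_sqrt_abs real_sqrt_le_iff)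
    then show ?case by simp
  qed
  from Lim_null_comparison[OF this lim] show ?thesis .
qed

lemma H_tendsto:
  assumes "N \<ge> 1"
  shows "\<forall>\<^sub>F n in sequentially. degree (H n) = N"
    and "(\<lambda>n. poly (H n) t) \<longlonglongrightarrow> poly (root_poly (mset_set (c ` {1..N}))) t"
proof -
  define X where "X = c ` {1..N}"
  have X: "finite X" "X \<noteq> {}" "card X = N" using assms c_inj by (auto simp: X_def card_image)
  obtain C where C: "\<And>x i. C x i \<ge> 0" "\<And>x i p. degree p \<le> N \<Longrightarrow> \<bar>taylor_coeff x i p\<bar> \<le> C x i * coeff_norm N p"
    using taylor_coeff_bound[of N] unfolding coeff_norm_def by metis
  \<comment> \<open>The total relative error at c_j: the ratio of S to P, and the ratios of lower to
    top Taylor coefficients of P, weighted by the constants that bound the Taylor coefficients of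
    H.\<close>
  define e where "e j n = \<bar>taylor_coeff (c j) (d j) (S n) / taylor_coeff (c j) (d j) (P n)\<bar>
     + (\<Sum>i=1..d j. \<bar>taylor_coeff (c j) (d j - i) (P n) / taylor_coeff (c j) (d j) (P n)\<bar> * C (c j) i)" for j n
  have e0: "e j n \<ge> 0" for j n unfolding e_def using C(1) by (intro add_nonneg_nonneg sum_nonneg) auto
  have elim0: "e j \<longlonglongrightarrow> 0" if j: "j \<in> {1..N}" for j
  proof -
    have "(\<lambda>n. taylor_coeff (c j) (d j - i) (P n) / taylor_coeff (c j) (d j) (P n)) \<longlonglongrightarrow> 0" if "i \<in> {1..d j}" for i
      using taylor_P_ratio_tendsto_0[of "- c j" "d j - i" "d j"] c_neg[OF j] that by simp
    then have "e j \<longlonglongrightarrow> \<bar>0\<bar> + (\<Sum>i=1..d j. \<bar>0\<bar> * C (c j) i)"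
      unfolding e_def by (intro tendsto_intros taylor_S_ratio_tendsto_0[OF j])
    then show ?thesis by simp
  qed
  define E where "E n = (\<Sum>j=1..N. e j n)" for n
  have "E \<longlonglongrightarrow> (\<Sum>j=1..N. 0)" unfolding E_def by (intro tendsto_sum elim0)
  then have E: "E \<longlonglongrightarrow> 0" by simp
  have "\<forall>\<^sub>F n in sequentially. \<bar>poly (H n) (c j)\<bar> \<le> E n * (1 + coeff_norm N (H n))" if j: "j \<in> {1..N}" for j
  proof -
    have "\<forall>\<^sub>F n in sequentially. taylor_coeff (c j) (d j) (P n) \<noteq> 0"
      using eventually_taylor_P_nonzero[of "- c j" "d j"] c_neg[OF j] by simp
    then show ?thesis using eventually_ge_at_top[of "2 * D"]
    proof eventually_elim
      case (elim n)
      let ?T = "\<lambda>i q. taylor_coeff (c j) i q" and ?M = "coeff_norm N (H n)"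
      have "?T (d j) (S n) = (\<Sum>i\<le>d j. ?T (d j - i) (P n) * ?T i (H n))"
        unfolding S_factor[of n] by (rule taylor_coeff_mult)
      also have "{..d j} = insert 0 {1..d j}" by auto
      also have "(\<Sum>i\<in>insert 0 {1..d j}. ?T (d j - i) (P n) * ?T i (H n))
          = ?T (d j) (P n) * poly (H n) (c j) + (\<Sum>i=1..d j. ?T (d j - i) (P n) * ?T i (H n))"
        by (subst sum.insert) auto
      \<comment> \<open>The Leibniz expansion solved for H(c_j). Its first part is small absolutely,
        the sum only relative to the coefficients of H, whence the factor 1 +
        \<open>coeff_norm N (H n)\<close>.\<close>
      finally have eqH: "poly (H n) (c j) = ?T (d j) (S n) / ?T (d j) (P n)
          - (\<Sum>i=1..d j. ?T (d j - i) (P n) / ?T (d j) (P n) * ?T i (H n))"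
        using elim by (simp add: field_simps sum_divide_distrib[symmetric])
      have 1: "\<bar>poly (H n) (c j)\<bar> \<le> \<bar>?T (d j) (S n) / ?T (d j) (P n)\<bar>
          + \<bar>\<Sum>i=1..d j. ?T (d j - i) (P n) / ?T (d j) (P n) * ?T i (H n)\<bar>"
        unfolding eqH by (rule abs_triangle_ineq4)
      have 2: "\<bar>\<Sum>i=1..d j. ?T (d j - i) (P n) / ?T (d j) (P n) * ?T i (H n)\<bar>
          \<le> (\<Sum>i=1..d j. \<bar>?T (d j - i) (P n) / ?T (d j) (P n)\<bar> * (C (c j) i * ?M))"
      proof (rule order_trans[OF sum_abs sum_mono])
        show "\<bar>?T (d j - i) (P n) / ?T (d j) (P n) * ?T i (H n)\<bar>
          \<le> \<bar>?T (d j - i) (P n) / ?T (d j) (P n)\<bar> * (C (c j) i * ?M)" for i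
          unfolding abs_mult using C(2)[OF degree_H_le[OF elim(2)]] by (intro mult_left_mono) auto
      qed
      have 3: "\<bar>?T (d j) (S n) / ?T (d j) (P n)\<bar> + (\<Sum>i=1..d j. \<bar>?T (d j - i) (P n) / ?T (d j) (P n)\<bar> * (C (c j) i * ?M))
          \<le> e j n * (1 + ?M)"
      proof -
        define u v where "u = \<bar>?T (d j) (S n) / ?T (d j) (P n)\<bar>"
          and "v = (\<Sum>i=1..d j. \<bar>?T (d j - i) (P n) / ?T (d j) (P n)\<bar> * C (c j) i)"
        have "u \<ge> 0" "v \<ge> 0" using C(1) by (auto simp: u_def v_def intro: sum_nonneg)
        moreover have "(\<Sum>i=1..d j. \<bar>?T (d j - i) (P n) / ?T (d j) (P n)\<bar> * (C (c j) i * ?M)) = v * ?M"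
          by (simp add: v_def sum_distrib_right mult.assoc)
        moreover have "e j n = u + v" by (simp add: e_def u_def v_def)
        moreover have "u * ?M \<ge> 0" using \<open>u \<ge> 0\<close> by simp
        ultimately show ?thesis unfolding u_def[symmetric] by (simp add: algebra_simps)
      qed
      have 4: "e j n * (1 + ?M) \<le> E n * (1 + ?M)"
        unfolding E_def using j e0 by (intro mult_right_mono member_le_sum) (auto intro: add_nonneg_nonneg)
      show ?case using 1 2 3 4 by linarith
    qed
  qed
  then have "\<forall>\<^sub>F n in sequentially. \<forall>j\<in>{1..N}. \<bar>poly (H n) (c j)\<bar> \<le> E n * (1 + coeff_norm N (H n))"
    by (intro eventually_ball_finite) auto
  then have ev: "\<forall>\<^sub>F n in sequentially. degree (H n) \<le> card X \<and> lead_coeff (H n) = 1 \<and>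
              (\<forall>x\<in>X. \<bar>poly (H n) x\<bar> \<le> E n * (1 + coeff_norm (card X) (H n)))"
    using eventually_ge_at_top[of "2 * D"]
    unfolding X(3) by eventually_elim (use degree_H_le lead_coeff_H in \<open>auto simp: X_def\<close>)
  show "\<forall>\<^sub>F n in sequentially. degree (H n) = N"
    using monic_tendsto_root_poly(1)[OF X(1,2) ev E] by (simp add: X(3))
  show "(\<lambda>n. poly (H n) t) \<longlonglongrightarrow> poly (root_poly (mset_set (c ` {1..N}))) t"
    using monic_tendsto_root_poly(2)[OF X(1,2) ev E] by (simp add: X_def)
qed

theorem S_roots_eventually:
  assumes "N \<ge> 1" "r > 0"
  shows "\<forall>\<^sub>F n in sequentially. N \<le> n \<and> (\<exists>\<zeta> X. S n = root_poly (mset_set (\<zeta> ` {1..N} \<union> X)) \<and>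
           finite X \<and> X \<subseteq> {0<..} \<and> card X = n - N \<and> inj_on \<zeta> {1..N} \<and>
           (\<forall>j\<in>{1..N}. \<zeta> j < 0 \<and> \<bar>\<zeta> j - c j\<bar> < r))"
proof -
  \<comment> \<open>A radius below all these numbers keeps the discs around the c_j disjoint, inside
    the negative axis and within the prescribed distance.\<close>
  define F where "F = insert r ((\<lambda>j. - c j) ` {1..N} \<union> 
     (\<lambda>(i, j). \<bar>c i - c j\<bar> / 2) ` {(i, j). (i, j) \<in> {1..N} \<times> {1..N} \<and> i \<noteq> j})"
  have finF: "finite F"
    unfolding F_def by (intro finite.insertI finite_UnI finite_imageI) 
      (auto intro: finite_subset[of _ "{1..N} \<times> {1..N}"])
  define r0 where "r0 = Min F"
  have F0: "F \<noteq> {}" by (simp add: F_def)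
  have "c i \<noteq> c j" if "i \<in> {1..N}" "j \<in> {1..N}" "i \<noteq> j" for i j
    using c_inj that by (metis inj_onD)
  then have "\<forall>x\<in>F. x > 0" using assms c_neg by (auto simp: F_def)
  then have r0: "r0 > 0" unfolding r0_def using finF F0 by simp
  have r0_le: "r0 \<le> x" if "x \<in> F" for x unfolding r0_def using finF that by simp
  have "r0 \<le> r" by (rule r0_le) (simp add: F_def)
  have r0c: "r0 \<le> - c j" if "j \<in> {1..N}" for j by (rule r0_le) (use that in \<open>auto simp: F_def\<close>)
  have r0d: "2 * r0 \<le> \<bar>c i - c j\<bar>" if "i \<in> {1..N}" "j \<in> {1..N}" "i \<noteq> j" for i j
  proof -
    have "r0 \<le> \<bar>c i - c j\<bar> / 2" by (rule r0_le) (use that in \<open>force simp: F_def\<close>)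
    then show ?thesis by simp
  qed
  have "\<forall>\<^sub>F n in sequentially. \<exists>z. \<bar>z - c j\<bar> < r0 \<and> poly (H n) z = 0" if j: "j \<in> {1..N}" for j
  proof (rule root_near_node[where X = "c ` {1..N}"])
    show "r0 < \<bar>c j - y\<bar>" if "y \<in> c ` {1..N}" "y \<noteq> c j" for y
      using that r0d[OF j] r0 by fastforce
  qed (use j r0 H_tendsto(2)[OF assms(1)] in auto)
  then have "\<forall>\<^sub>F n in sequentially. \<forall>j\<in>{1..N}. \<exists>z. \<bar>z - c j\<bar> < r0 \<and> poly (H n) z = 0"
    by (intro eventually_ball_finite) auto
  then show ?thesis
    using H_tendsto(1)[OF assms(1)] eventually_ge_at_top[of "2 * D"]
  proof eventually_elim
    case (elim n)
    obtain \<zeta> where \<zeta>: "\<And>j. j \<in> {1..N} \<Longrightarrow> \<bar>\<zeta> j - c j\<bar> < r0 \<and> poly (H n) (\<zeta> j) = 0"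
      using elim(1) by metis
    have neg: "\<zeta> j < 0" if "j \<in> {1..N}" for j using \<zeta>[OF that] r0c[OF that] by linarith
    have inj: "inj_on \<zeta> {1..N}"
    proof (rule inj_onI, rule ccontr)
      fix i j assume ij: "i \<in> {1..N}" "j \<in> {1..N}" "\<zeta> i = \<zeta> j" "i \<noteq> j"
      then show False using \<zeta>[of i] \<zeta>[of j] r0d[of i j] by linarith
    qed
    have nN: "size (Z n) + N = n" using degree_H[of n] elim(2) by simp
    define X where "X = odd_roots_in {0<..} (S n)"
    have X: "finite X" "X \<subseteq> {x\<in>{0<..}. poly (S n) x = 0}" unfolding X_def
      by (rule finite_odd_roots_in[OF S_nonzero], rule odd_roots_in_subset)
    \<comment> \<open>Two bounds meet: at least n - N zeros of odd order by the Rolle count, and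
      only n - N positive zeros with multiplicity because H has degree N. So the positive zeros are
      distinct.\<close>
    have cX: "card X = n - N"
      using is_orth_many_odd_roots[OF is_orth_S elim(3)] card_odd_roots_le_size_Z[of n] nN unfolding X_def by linarith
    have "\<zeta> ` {1..N} \<inter> X = {}" using X(2) neg by force
    then have "card (\<zeta> ` {1..N} \<union> X) = N + card X"
      using X(1) inj by (subst card_Un_disjoint) (auto simp: card_image)
    then have "card (\<zeta> ` {1..N} \<union> X) = n" using cX nN by simp
    moreover have "\<forall>x\<in>\<zeta> ` {1..N} \<union> X. poly (S n) x = 0"
      using \<zeta> X(2) by (auto simp: S_factor[of n])
    ultimately have "S n = root_poly (mset_set (\<zeta> ` {1..N} \<union> X))"
      using X(1) by (intro monic_eq_root_poly[OF degree_S lead_coeff_S]) auto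
    moreover have "X \<subseteq> {0<..}" using X(2) by auto
    moreover have "\<forall>j\<in>{1..N}. \<zeta> j < 0 \<and> \<bar>\<zeta> j - c j\<bar> < r" using \<zeta> neg \<open>r0 \<le> r\<close> by fastforce
    ultimately show ?case using X(1) cX inj nN by (intro conjI exI[of _ \<zeta>] exI[of _ X]) auto
  qed
qed

end

text \<open>The hull of the lower orders always contains 0. If c_i < c_j held although d_i < d_j,
  that hull would contain the open interval from c_i to 0, and c_j would be one of its interior
  points.\<close>

lemma sequentially_ordered_imp:
  assumes seq: "sequentially_ordered N c d" and mono: "mono_on {1..N} d"
    and neg: "\<forall>j\<in>{1..N}. c j < 0" and inj: "inj_on c {1..N}"
    and ij: "i \<in> {1..N}" "j \<in> {1..N}" "d i < d j"
  shows "c j < c i"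
proof (rule ccontr)
  assume "\<not> c j < c i"
  moreover have "c i \<noteq> c j" using inj ij by (auto dest: inj_onD)
  ultimately have less: "c i < c j" by simp
  define U where "U = convex hull (\<Union>l\<in>{0..d j - 1}. sobolev_hull N c d l)"
  have sub: "sobolev_hull N c d l \<subseteq> U" if "l \<le> d j - 1" for l
    unfolding U_def using that by (intro order_trans[OF UN_upper hull_subset]) auto
  have in_hull: "c m \<in> sobolev_hull N c d (d m)" if "m \<in> {1..N}" for m
    unfolding sobolev_hull_def using that by (intro hull_inc) auto
  have "d i \<le> d j - 1" using ij(3) by simp
  then have "c i \<in> U" using sub in_hull[OF ij(1)] by blast
  moreover have "0 \<in> U"
  proof -
    have "0 \<in> sobolev_hull N c d 0" unfolding sobolev_hull_def by (intro hull_inc) auto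
    then show ?thesis using sub[of 0] by blast
  qed
  moreover have "is_interval U" unfolding U_def is_interval_convex_1 by (rule convex_convex_hull)
  ultimately have "x \<in> U" if "c i < x" "x < 0" for x
    using that unfolding is_interval_1 by (meson less_imp_le)
  then have "{c i<..<0} \<subseteq> U" by auto
  then have "{c i<..<0} \<subseteq> interior U" by (intro interior_maximal) auto
  then have "c j \<in> interior U" using less neg ij by auto
  moreover have "d j \<le> d N" using mono ij by (auto simp: mono_on_def)
  then have "d j \<in> {1..d N}" using ij(3) by auto
  then have "sobolev_hull N c d (d j) \<inter> interior U = {}"
    using seq unfolding sequentially_ordered_def U_def by blast
  ultimately show False using in_hull[OF ij(2)] by auto
qed

section \<open>Passage from real to complex zeros\<close>

lemma map_poly_of_real_mult:
  "map_poly complex_of_real (p * q) = map_poly complex_of_real p * map_poly complex_of_real q"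
  by (intro poly_eqI) (simp add: coeff_map_poly coeff_mult)

lemma proots_of_real_root_poly:
  "proots (map_poly complex_of_real (root_poly A)) = image_mset complex_of_real A"
proof (induction A)
  case (add a A)
  have "map_poly complex_of_real (root_poly A) \<noteq> 0"
    by (metis coeff_0 coeff_map_poly lead_coeff_root_poly of_real_0 of_real_1 zero_neq_one)
  moreover have "map_poly complex_of_real [:- a, 1:] = [:- complex_of_real a, 1:]"
    by (simp add: map_poly_pCons)
  ultimately show ?case
    using add by (simp add: map_poly_of_real_mult proots_mult del: mult_pCons_left)
qed (simp add: map_poly_1)

theorem corollary2p1:
  fixes \<alpha> :: real and N :: nat and w c :: "nat \<Rightarrow> real" and d :: "nat \<Rightarrow> nat"
    and S :: "nat \<Rightarrow> complex poly"
  assumes "\<alpha> > -1" and "N \<ge> 1"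
    and "mono_on {1..N} d"
    and "\<forall>j\<in>{1..N}. w j > 0"
    and "\<forall>j\<in>{1..N}. c j < 0" and "inj_on c {1..N}"
    and "sequentially_ordered N c d"
    and S: "\<And>n. S n = map_poly complex_of_real (sobolev_poly \<alpha> N w c d n)"
  shows "(\<forall>r>0. \<exists>n0. \<forall>n\<ge>n0. N \<le> n \<and>
            (\<exists>\<xi> :: nat \<Rightarrow> complex.
               proots (S n) = image_mset \<xi> (mset_set {1..n}) \<and>
               (\<forall>j\<in>{1..N}. \<xi> j \<in> ball (complex_of_real (c j)) r) \<and>
               (\<forall>i\<in>{N+1..n}. \<xi> i \<in> complex_of_real ` {0<..})))
       \<and> (\<exists>n0. \<forall>n\<ge>n0. \<forall>z. poly (S n) z = 0 \<longrightarrow> z \<in> \<real> \<and> order z (S n) = 1)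
       \<and> (\<exists>M>0. \<forall>n\<ge>1. \<forall>z. poly (S n) z = 0 \<longrightarrow>
            (INF x\<in>{0<..}. cmod (complex_of_real x - z)) < M)"
proof -
  interpret Pos: positive_functional "laguerre_integral \<alpha>"
    by (rule positive_functional_laguerre) fact
  \<comment> \<open>The parameter is shifted to a = \<alpha> + 1, so that the moments are
    \<open>Gamma a * pochhammer a k\<close>.\<close>
  interpret LS: laguerre_sobolev "laguerre_integral \<alpha>" "\<alpha> + 1" N w c d
    using assms sequentially_ordered_imp[of N c d]
    by unfold_locales (auto simp: laguerre_integral_monom)
  have B: "LS.B = sobolev_inner \<alpha> N w c d"
    by (intro ext) (simp add: LS.B_def sobolev_inner_def laguerre_integral_def)
  have SLS: "S n = map_poly complex_of_real (LS.S n)" for n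
  proof -
    have "LS.is_orth n = (\<lambda>p. degree p = n \<and> lead_coeff p = 1 \<and>
        (\<forall>k<n. sobolev_inner \<alpha> N w c d (monom 1 k) p = 0))"
      by (intro ext) (simp add: LS.is_orth_def flip: B)
    then show ?thesis by (simp add: S sobolev_poly_def LS.S_def)
  qed
  have S0: "S n \<noteq> 0" for n
    unfolding SLS by (metis LS.lead_coeff_S coeff_0 coeff_map_poly of_real_0 of_real_1 zero_neq_one)
  have loc: "\<exists>n0. \<forall>n\<ge>n0. N \<le> n \<and> (\<exists>\<zeta> X. proots (S n) = image_mset complex_of_real (mset_set (\<zeta> ` {1..N} \<union> X)) \<and>
           finite X \<and> X \<subseteq> {0<..} \<and> card X = n - N \<and> inj_on \<zeta> {1..N} \<and>
           (\<forall>j\<in>{1..N}. \<zeta> j < 0 \<and> \<bar>\<zeta> j - c j\<bar> < r))" if r: "r > 0" for r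
  proof -
    obtain n0 where "\<forall>n\<ge>n0. N \<le> n \<and> (\<exists>\<zeta> X. LS.S n = root_poly (mset_set (\<zeta> ` {1..N} \<union> X)) \<and>
           finite X \<and> X \<subseteq> {0<..} \<and> card X = n - N \<and> inj_on \<zeta> {1..N} \<and>
           (\<forall>j\<in>{1..N}. \<zeta> j < 0 \<and> \<bar>\<zeta> j - c j\<bar> < r))"
      using LS.S_roots_eventually[OF \<open>N \<ge> 1\<close> r] unfolding eventually_sequentially by blast
    then show ?thesis unfolding SLS by (metis proots_of_real_root_poly)
  qed
  have part1: "\<exists>n0. \<forall>n\<ge>n0. N \<le> n \<and>
            (\<exists>\<xi> :: nat \<Rightarrow> complex.
               proots (S n) = image_mset \<xi> (mset_set {1..n}) \<and>
               (\<forall>j\<in>{1..N}. \<xi> j \<in> ball (complex_of_real (c j)) r) \<and>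
               (\<forall>i\<in>{N+1..n}. \<xi> i \<in> complex_of_real ` {0<..}))" if r: "r > 0" for r
  proof -
    obtain n0 where n0: "\<forall>n\<ge>n0. N \<le> n \<and> (\<exists>\<zeta> X. proots (S n) = image_mset complex_of_real (mset_set (\<zeta> ` {1..N} \<union> X)) \<and>
           finite X \<and> X \<subseteq> {0<..} \<and> card X = n - N \<and> inj_on \<zeta> {1..N} \<and>
           (\<forall>j\<in>{1..N}. \<zeta> j < 0 \<and> \<bar>\<zeta> j - c j\<bar> < r))" using loc[OF r] by blast
    have "\<exists>\<xi> :: nat \<Rightarrow> complex.
               proots (S n) = image_mset \<xi> (mset_set {1..n}) \<and>
               (\<forall>j\<in>{1..N}. \<xi> j \<in> ball (complex_of_real (c j)) r) \<and>
               (\<forall>i\<in>{N+1..n}. \<xi> i \<in> complex_of_real ` {0<..})" if n: "n \<ge> n0" for n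
    proof -
      obtain \<zeta> X where \<zeta>: "proots (S n) = image_mset complex_of_real (mset_set (\<zeta> ` {1..N} \<union> X))"
           "finite X" "X \<subseteq> {0<..}" "card X = n - N" "inj_on \<zeta> {1..N}"
           "\<And>j. j \<in> {1..N} \<Longrightarrow> \<zeta> j < 0 \<and> \<bar>\<zeta> j - c j\<bar> < r" and nN: "N \<le> n"
        using n0 n by blast
      obtain x where x: "bij_betw x {N+1..n} X"
        using finite_same_card_bij[of "{N+1..n}" X] \<zeta>(2,4) by auto
      define f where "f i = (if i \<le> N then \<zeta> i else x i)" for i
      have "bij_betw f {1..N} (\<zeta> ` {1..N})"
        using \<zeta>(5) by (intro bij_betw_cong[THEN iffD2, OF _ inj_on_imp_bij_betw]) (auto simp: f_def)
      moreover have "bij_betw f {N+1..n} X"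
        using x by (intro bij_betw_cong[THEN iffD2, OF _ x]) (auto simp: f_def)
      moreover have "\<zeta> ` {1..N} \<inter> X = {}" using \<zeta>(3,6) by force
      ultimately have "bij_betw f ({1..N} \<union> {N+1..n}) (\<zeta> ` {1..N} \<union> X)"
        by (rule bij_betw_combine)
      moreover have "{1..N} \<union> {N+1..n} = {1..n}" using nN by auto
      ultimately have "image_mset f (mset_set {1..n}) = mset_set (\<zeta> ` {1..N} \<union> X)"
        by (simp add: bij_betw_def image_mset_mset_set)
      then have "proots (S n) = image_mset (complex_of_real \<circ> f) (mset_set {1..n})"
        unfolding \<zeta>(1) by (simp flip: image_mset.compositionality)
      moreover have "(complex_of_real \<circ> f) j \<in> ball (complex_of_real (c j)) r" if "j \<in> {1..N}" for j
        using \<zeta>(6)[OF that] that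
        by (simp add: f_def dist_norm abs_minus_commute flip: of_real_diff)
      moreover have "(complex_of_real \<circ> f) i \<in> complex_of_real ` {0<..}" if "i \<in> {N+1..n}" for i
        unfolding o_def using bij_betwE[OF \<open>bij_betw f {N+1..n} X\<close>] that \<zeta>(3) by (intro imageI) blast
      ultimately show ?thesis by blast
    qed
    then show ?thesis using n0 by blast
  qed
  have roots: "z \<in># proots (S n) \<longleftrightarrow> poly (S n) z = 0" for n z using S0 by simp
  have part2: "\<exists>n0. \<forall>n\<ge>n0. \<forall>z. poly (S n) z = 0 \<longrightarrow> z \<in> \<real> \<and> order z (S n) = 1"
  proof -
    obtain n0 where n0: "\<forall>n\<ge>n0. N \<le> n \<and> (\<exists>\<zeta> X. proots (S n) = image_mset complex_of_real (mset_set (\<zeta> ` {1..N} \<union> X)) \<and>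
           finite X \<and> X \<subseteq> {0<..} \<and> card X = n - N \<and> inj_on \<zeta> {1..N} \<and>
           (\<forall>j\<in>{1..N}. \<zeta> j < 0 \<and> \<bar>\<zeta> j - c j\<bar> < 1))" using loc[of 1] by auto
    have "z \<in> \<real> \<and> order z (S n) = 1" if n: "n \<ge> n0" and z: "poly (S n) z = 0" for n z
    proof -
      obtain R where R: "finite R" "proots (S n) = image_mset complex_of_real (mset_set R)"
        using n0 n by (metis finite_UnI finite_imageI finite_atLeastAtMost)
      \<comment> \<open>All multiplicities are one because the zeros form the injective image of a
        finite set.\<close>
      have eq: "proots (S n) = mset_set (complex_of_real ` R)"
        unfolding R(2) by (intro image_mset_mset_set) (auto simp: inj_on_def)
      then have "z \<in> complex_of_real ` R" using z roots[of z n] R(1) by simp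
      moreover have "order z (S n) = count (proots (S n)) z" using S0 by simp
      ultimately show ?thesis unfolding eq using R(1) by auto
    qed
    then show ?thesis by blast
  qed
  have INF_le: "(INF x\<in>{0<..}. cmod (complex_of_real x - z)) \<le> cmod (complex_of_real y - z)" if "y > 0" for y z
    using that by (intro cINF_lower bdd_belowI[of _ 0]) auto
  have part3: "\<exists>M>0. \<forall>n\<ge>1. \<forall>z. poly (S n) z = 0 \<longrightarrow> (INF x\<in>{0<..}. cmod (complex_of_real x - z)) < M"
  proof -
    obtain n0 where n0: "\<forall>n\<ge>n0. N \<le> n \<and>
            (\<exists>\<xi> :: nat \<Rightarrow> complex.
               proots (S n) = image_mset \<xi> (mset_set {1..n}) \<and>
               (\<forall>j\<in>{1..N}. \<xi> j \<in> ball (complex_of_real (c j)) 1) \<and>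
               (\<forall>i\<in>{N+1..n}. \<xi> i \<in> complex_of_real ` {0<..}))" using part1[of 1] by auto
    \<comment> \<open>Distances are measured to the point 1 of the half-line. Finitely many indices
      remain below \<open>n0\<close>, and each polynomial has finitely many zeros.\<close>
    define K where "K = (\<lambda>z. cmod (1 - z)) ` (\<Union>n\<in>{..<n0}. {z. poly (S n) z = 0})"
    have finK: "finite K" unfolding K_def using S0 poly_roots_finite by auto
    \<comment> \<open>Inserting 0 covers the case of empty \<open>K\<close>. A zero in the unit disc
      around c_i is at distance less than 2 + |c_i| from 1, and the summand 3 leaves room for strict
      inequalities.\<close>
    define M where "M = Max (insert 0 K) + (\<Sum>j=1..N. \<bar>c j\<bar>) + 3"
    have "Max (insert 0 K) \<ge> 0" using finK by simp
    moreover have "(\<Sum>j=1..N. \<bar>c j\<bar>) \<ge> 0" by (simp add: sum_nonneg)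
    ultimately have M: "M > 0" "Max (insert 0 K) < M" "(\<Sum>j=1..N. \<bar>c j\<bar>) + 2 < M" unfolding M_def by linarith+
    have "(INF x\<in>{0<..}. cmod (complex_of_real x - z)) < M" if z: "poly (S n) z = 0" for n z
    proof (cases "n < n0")
      case True
      then have "cmod (1 - z) \<in> insert 0 K" using z by (auto simp: K_def)
      then have "cmod (1 - z) \<le> Max (insert 0 K)" using finK by simp
      then show ?thesis using INF_le[of 1 z] M(2) by simp
    next
      case False
      then obtain \<xi> :: "nat \<Rightarrow> complex" where \<xi>: "proots (S n) = image_mset \<xi> (mset_set {1..n})"
               "\<And>j. j \<in> {1..N} \<Longrightarrow> \<xi> j \<in> ball (complex_of_real (c j)) 1"
               "\<And>i. i \<in> {N+1..n} \<Longrightarrow> \<xi> i \<in> complex_of_real ` {0<..}"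
        using n0 by (metis not_less)
      obtain i where i: "i \<in> {1..n}" "z = \<xi> i" using z roots[of z n] unfolding \<xi>(1) by auto
      show ?thesis
      proof (cases "i \<le> N")
        case True
        then have iN: "i \<in> {1..N}" using i by auto
        have "cmod (1 - z) \<le> cmod (1 - complex_of_real (c i)) + cmod (complex_of_real (c i) - z)"
          by (metis dist_norm dist_triangle)
        also have "cmod (complex_of_real (c i) - z) < 1" using \<xi>(2)[OF iN] i by (simp add: dist_norm)
        also have "cmod (1 - complex_of_real (c i)) \<le> 1 + \<bar>c i\<bar>"
          using norm_triangle_ineq4[of 1 "complex_of_real (c i)"] by simp
        also have "\<bar>c i\<bar> \<le> (\<Sum>j=1..N. \<bar>c j\<bar>)" using iN by (intro member_le_sum) auto
        finally show ?thesis using INF_le[of 1 z] M(3) by simp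
      next
        case False
        then obtain x where "x > 0" "z = complex_of_real x" using \<xi>(3)[of i] i by auto
        then show ?thesis using INF_le[of x z] M(1) by simp
      qed
    qed
    then show ?thesis using M(1) by blast
  qed
  show ?thesis using part1 part2 part3 by blast
qed

end
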